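(* Let $R>0$ and $\kappa\ge0$, and let $(M,g)=(\mathbb{D}_R,g_\kappa)$, where $\mathbb{D}_R=\{(x,y)\in\mathbb{R}^2: x^2+y^2\le R^2\}$ and $g_\kappa$ is given in polar coordinates by $(1+\kappa r^2)^2dr^2+r^2d\theta^2$. Define $R_1:=Re^{\kappa R^2/2}$ and $R_2:=2Re^{\kappa R^2}>R_1$. Fix an integer $m\ge0$. If $a\in\mathcal{H}_m$ extends smoothly to $\mathbb{D}_{R_2}$, then there exists $f\in\mathcal{A}_m(Z)$ such that $\pi_{m*}f=a$. Equivalently, for $\phi$ the unique element of $\Omega_m\cap\ker\eta_-$ associated with $a$, there exists $u\in C^\infty(SM)$ such that $Xu=0$, $u_m=\phi$ and $u_k=0$ for all $k<m$.
   Context: $M$ has its standard orientation; $SM$ is the unit tangent bundle of $(M,g)$, $Z=BM=\{(x,v)\in TM: g_x(v,v)\le1\}$, and $\mathbb{D}$ is the closed unit disk in $\mathbb{C}$. The metric and orientation define the rotation by $+90$ degrees $\iota$ on $TM$ (which gives $M$ its complex structure) and $\omega\cdot v=\mathrm{Re}(\omega)v+\mathrm{Im}(\omega)\iota v$ for $\omega\in\mathbb{C}$. $X$ is the generator of the geodesic flow on $SM$, $V$ the generator of the circle action $(x,v)\mapsto(x,e^{it}\cdot v)$, and $\eta_\pm=\frac12(X\pm i[X,V])$. For $k\in\mathbb{Z}$, $\Omega_k=\{f\in C^\infty(SM): Vf=ikf\}$; every $u\in C^\infty(SM)$ decomposes uniquely as $u=\sum_{k\in\mathbb{Z}}u_k$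 with $u_k\in\Omega_k$. The transport twistor space is $(Z,\mathscr{D})$, where $\mathscr{D}\subset T_{\mathbb{C}}Z$ is the complex rank-2 distribution obtained as pushforward, under $SM\times\mathbb{D}\to Z$, $(x,v,\omega)\mapsto(x,\omega\cdot v)$, of $\mathrm{span}\{\eta_-+\omega^2\eta_+,\partial_{\bar\omega}\}$. Set $$\mathcal{A}(Z)=\{u\in C^\infty(Z): du(\mathscr{D})=0\},\qquad \mathcal{A}_m(Z)=\Big\{f\in\mathcal{A}(Z): f|_{SM}=\sum_{k\ge m}u_k,\ u_k\in\Omega_k\Big\}.$$ $\mathcal{H}_m=\{a\in C^\infty(M,\otimes^m(T^{1,0}M)^* ):\bar\partial a=0\}$ is the space of holomorphic $m$-differentials, smooth up to the boundary. The map sending $a\in\mathcal{H}_m$ to the function $(x,v)\mapsto a_x(v^{\otimes m})$ on $SM$ is a bijection $\mathcal{H}_m\to\Omega_m\cap\ker\eta_-$; the image of $a$ is the element of $\Omega_m\cap\ker\eta_-$ associated with $a$. For $f\in\mathcal{A}_m(Z)$, the Fourier mode $(f|_{SM})_m$ lies in $\Omega_m\cap\ker\eta_-$, and $\pi_{m*}f$ denotes the corresponding element of $\mathcal{H}_m$. With $z=x+iy$, a global holomorphic coordinate on $(\mathbb{D}_R,g_\kappa)$ is $\zeta=ze^{\kappa z\bar z/2}\in\mathbb{D}_{R_1}$, where $\mathbb{D}_\rho$ is the closed disk of radius $\rho$. Every $a\in\mathcal{H}_m$ is of the form $A(\zeta)\,d\zeta^m$ with $A\in C^\infty(\mathbb{D}_{R_1})$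 holomorphic in the interior, so $A(\zeta)=\sum_{k\ge0}A_k\zeta^k$ with radius of convergence at least $R_1$. One says that $a$ *extends smoothly to $\mathbb{D}_{R_2}$* if the radius of convergence of this power series is at least $R_2$ and its sum extends to a smooth function on the closed disk $\mathbb{D}_{R_2}$. *)

theory Defs
  imports "HOL-Analysis.Analysis"
begin

text \<open>
  The first argument is meant to be open; all directional derivatives of order up to \<open>k\<close>
  exist and are continuous.
\<close>

primrec Ck_on :: "nat \<Rightarrow> 'a::real_normed_vector set \<Rightarrow> ('a \<Rightarrow> 'b::real_normed_vector) \<Rightarrow> bool" where
  "Ck_on 0 U f \<longleftrightarrow> continuous_on U f"
| "Ck_on (Suc k) U f \<longleftrightarrow>
     (\<forall>x\<in>U. f differentiable (at x)) \<and> (\<forall>h. Ck_on k U (\<lambda>x. frechet_derivative f (at x) h))"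

text \<open>
  Functions on \<open>M\<close>, \<open>SM\<close> and \<open>Z\<close> are total functions on the ambient real vector space of which
  only the values on the set matter. Smoothness up to the boundary is smoothness of an
  extension to an ambient open neighbourhood.
\<close>

definition smooth_extension ::
    "'a::real_normed_vector set \<Rightarrow> ('a \<Rightarrow> 'b::real_normed_vector) \<Rightarrow> 'a set \<Rightarrow> ('a \<Rightarrow> 'b) \<Rightarrow> bool" where
  "smooth_extension S f U F \<longleftrightarrow>
     open U \<and> S \<subseteq> U \<and> (\<forall>k. Ck_on k U F) \<and> (\<forall>x\<in>S. F x = f x)"

definition smooth_on :: "'a::real_normed_vector set \<Rightarrow> ('a \<Rightarrow> 'b::real_normed_vector) \<Rightarrow> bool" where
  "smooth_on S f \<longleftrightarrow> (\<exists>U F. smooth_extension S f U F)"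

text \<open>
  \<open>f\<close> is smooth on \<open>S\<close> and \<open>\<xi> f = h\<close> on \<open>S\<close>. It is used for fields \<open>\<xi>\<close> tangent to the manifold
  with boundary \<open>S\<close>, for which the derivative does not depend on the extension.
\<close>

definition has_lie_derivative_on ::
    "'a::real_normed_vector set \<Rightarrow> ('a \<Rightarrow> 'a) \<Rightarrow> ('a \<Rightarrow> complex) \<Rightarrow> ('a \<Rightarrow> complex) \<Rightarrow> bool" where
  "has_lie_derivative_on S \<xi> f h \<longleftrightarrow>
     (\<exists>U F. smooth_extension S f U F \<and> (\<forall>p\<in>S. frechet_derivative F (at p) (\<xi> p) = h p))"

text \<open>Sign convention: \<open>[X, Y] f = X (Y f) - Y (X f)\<close>.\<close>

definition lie_bracket ::
    "('a::real_normed_vector \<Rightarrow> 'a) \<Rightarrow> ('a \<Rightarrow> 'a) \<Rightarrow> 'a \<Rightarrow> 'a" where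
  "lie_bracket X Y p = frechet_derivative Y (at p) (X p) - frechet_derivative X (at p) (Y p)"

text \<open>
  A complexified tangent vector is a pair \<open>(a, b)\<close> of real ones, standing for \<open>a + \<i> b\<close>.
\<close>

definition cscale :: "complex \<Rightarrow> 'a::real_vector \<times> 'a \<Rightarrow> 'a \<times> 'a" where
  "cscale c \<xi> = (Re c *\<^sub>R fst \<xi> - Im c *\<^sub>R snd \<xi>, Re c *\<^sub>R snd \<xi> + Im c *\<^sub>R fst \<xi>)"

definition capply :: "('a \<Rightarrow> complex) \<Rightarrow> 'a \<times> 'a \<Rightarrow> complex" where
  "capply L \<xi> = L (fst \<xi>) + \<i> * L (snd \<xi>)"

text \<open>
  Points and tangent vectors of the plane are complex numbers. Since \<open>r dr = x dx + y dy\<close> and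
  \<open>r\<^sup>2 d\<theta>\<^sup>2 = dx\<^sup>2 + dy\<^sup>2 - dr\<^sup>2\<close>, the metric is
  \<open>dx\<^sup>2 + dy\<^sup>2 + ((1 + \<kappa> r\<^sup>2)\<^sup>2 - 1) / r\<^sup>2 (x dx + y dy)\<^sup>2\<close>. It is smooth on the whole plane.
\<close>

definition metric :: "real \<Rightarrow> complex \<Rightarrow> complex \<Rightarrow> complex \<Rightarrow> real" where
  "metric \<kappa> x v w = v \<bullet> w + (2 * \<kappa> + \<kappa>\<^sup>2 * (x \<bullet> x)) * (x \<bullet> v) * (x \<bullet> w)"

lemma metric_polar:
  "metric \<kappa> (of_real r * cis \<theta>)
      (of_real a * cis \<theta> + of_real (r * b) * (\<i> * cis \<theta>))
      (of_real a * cis \<theta> + of_real (r * b) * (\<i> * cis \<theta>))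
   = (1 + \<kappa> * r\<^sup>2)\<^sup>2 * a\<^sup>2 + r\<^sup>2 * b\<^sup>2"
proof -
  have cs: "(cos \<theta>)\<^sup>2 = 1 - (sin \<theta>)\<^sup>2"
    by (simp add: cos_squared_eq)
  let ?x = "of_real r * cis \<theta>"
  let ?v = "of_real a * cis \<theta> + of_real (r * b) * (\<i> * cis \<theta>)"
  have 1: "?x \<bullet> ?x = r\<^sup>2"
    unfolding inner_complex_def power2_eq_square using cs by (simp add: power2_eq_square) algebra
  have 2: "?x \<bullet> ?v = r * a"
    unfolding inner_complex_def using cs by (simp add: power2_eq_square) algebra
  have 3: "?v \<bullet> ?v = a\<^sup>2 + r\<^sup>2 * b\<^sup>2"
    unfolding inner_complex_def using cs by (simp add: power2_eq_square) algebra
  show ?thesis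
    unfolding metric_def 1 2 3 by (simp add: power2_eq_square algebra_simps)
qed

text \<open>Rotation by \<open>+90\<close> degrees with respect to the metric and the standard orientation.\<close>

definition rot :: "real \<Rightarrow> complex \<Rightarrow> complex \<Rightarrow> complex" where
  "rot \<kappa> x v = (THE w. metric \<kappa> x v w = 0 \<and> metric \<kappa> x w w = metric \<kappa> x v v \<and> 0 \<le> Im (cnj v * w))"

definition act :: "real \<Rightarrow> complex \<Rightarrow> complex \<Rightarrow> complex \<Rightarrow> complex" where
  "act \<kappa> x \<omega> v = Re \<omega> *\<^sub>R v + Im \<omega> *\<^sub>R rot \<kappa> x v"

text \<open>
  The geodesic equation is \<open>x'' = - \<Gamma>\<^sub>x(x', x')\<close>, where \<open>\<Gamma>\<^sub>x(v, v)\<close> is given by the Koszul formula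
  for constant vector fields \<open>v\<close>, \<open>h\<close>.
\<close>

definition christoffel :: "real \<Rightarrow> complex \<Rightarrow> complex \<Rightarrow> complex" where
  "christoffel \<kappa> x v = (THE w. \<forall>h. metric \<kappa> x w h =
      frechet_derivative (\<lambda>y. metric \<kappa> y v h) (at x) v
      - frechet_derivative (\<lambda>y. metric \<kappa> y v v) (at x) h / 2)"

text \<open>The definite descriptions denote.\<close>

lemma rot_eq:
  assumes "0 \<le> \<kappa>"
  shows "rot \<kappa> x v = \<i> * (v + of_real ((2 * \<kappa> + \<kappa>\<^sup>2 * (x \<bullet> x)) * (x \<bullet> v)) * x) / of_real (1 + \<kappa> * (x \<bullet> x))"
proof -
  define x1 x2 v1 v2 where defs: "x1 = Re x" "x2 = Im x" "v1 = Re v" "v2 = Im v"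
  define p where "p = 2 * \<kappa> + \<kappa>\<^sup>2 * (x1\<^sup>2 + x2\<^sup>2)"
  define s where "s = 1 + \<kappa> * (x1\<^sup>2 + x2\<^sup>2)"
  have s1: "s \<ge> 1" and p0: "p \<ge> 0" unfolding s_def p_def using assms by auto
  have s2: "s\<^sup>2 = 1 + p * (x1\<^sup>2 + x2\<^sup>2)"
    unfolding s_def p_def by (simp add: power2_eq_square algebra_simps)
  define a where "a = v1 + p * (x1 * v1 + x2 * v2) * x1"
  define b where "b = v2 + p * (x1 * v1 + x2 * v2) * x2"
  define q where "q = v1\<^sup>2 + v2\<^sup>2 + p * (x1 * v1 + x2 * v2)\<^sup>2"
  have g: "metric \<kappa> x u w = Re u * Re w + Im u * Im w + p * (x1 * Re u + x2 * Im u) * (x1 * Re w + x2 * Im w)"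
    for u w unfolding metric_def p_def defs by (simp add: inner_complex_def power2_eq_square)
  have q_ab: "q = a * v1 + b * v2"
    unfolding q_def a_def b_def by (simp add: power2_eq_square algebra_simps)
  have q0: "q \<ge> 0" unfolding q_def using p0 by simp
  let ?w = "Complex (- b / s) (a / s)"
  have rhs: "\<i> * (v + of_real ((2 * \<kappa> + \<kappa>\<^sup>2 * (x \<bullet> x)) * (x \<bullet> v)) * x) / of_real (1 + \<kappa> * (x \<bullet> x)) = ?w"
  proof -
    have "1 + \<kappa> * (x \<bullet> x) = s" "2 * \<kappa> + \<kappa>\<^sup>2 * (x \<bullet> x) = p" "x \<bullet> v = x1 * v1 + x2 * v2"
      by (simp_all add: s_def p_def defs inner_complex_def power2_eq_square)
    then show ?thesis
      by (simp add: complex_eq_iff a_def b_def defs Re_divide_of_real Im_divide_of_real)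
  qed
  have sp: "s > 0" using s1 by simp
  have w0: "metric \<kappa> x v ?w = 0"
  proof -
    have "metric \<kappa> x v ?w = (a * (- b) + b * a) / s"
      unfolding g a_def b_def defs[symmetric] by (simp add: divide_simps sp algebra_simps)
    then show ?thesis by simp
  qed
  have w1: "metric \<kappa> x ?w ?w = metric \<kappa> x v v"
  proof -
    have "b\<^sup>2 + a\<^sup>2 + p * (x2 * a - x1 * b)\<^sup>2 = q + p * (x1\<^sup>2 + x2\<^sup>2) * q"
      unfolding q_def a_def b_def by (simp add: power2_eq_square algebra_simps)
    then have e: "b\<^sup>2 + a\<^sup>2 + p * (x2 * a - x1 * b)\<^sup>2 = s\<^sup>2 * q"
      unfolding s2 by (simp add: algebra_simps)
    have "metric \<kappa> x ?w ?w = (b\<^sup>2 + a\<^sup>2 + p * (x2 * a - x1 * b)\<^sup>2) / s\<^sup>2"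
      unfolding g using sp by (simp add: field_simps power2_eq_square)
    also have "\<dots> = q" unfolding e using sp by simp
    also have "q = metric \<kappa> x v v"
      unfolding q_def g defs by (simp add: power2_eq_square)
    finally show ?thesis .
  qed
  have w2: "Im (cnj v * ?w) = q / s"
    unfolding q_ab defs by (simp add: add_divide_distrib algebra_simps)
  have uniq: "w = ?w" if w: "metric \<kappa> x v w = 0 \<and> metric \<kappa> x w w = metric \<kappa> x v v \<and> 0 \<le> Im (cnj v * w)" for w
  proof -
    define c d where cd: "c = Re w" "d = Im w"
    have o: "a * c + b * d = 0"
      using w unfolding g a_def b_def cd defs by (simp add: algebra_simps)
    have n: "c\<^sup>2 + d\<^sup>2 + p * (x1 * c + x2 * d)\<^sup>2 = q"
      using w unfolding g q_def cd defs by (simp add: power2_eq_square)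
    have t: "v1 * d - v2 * c \<ge> 0" using w by (simp add: cd defs)
    have "q * (c\<^sup>2 + d\<^sup>2 + p * (x1 * c + x2 * d)\<^sup>2) - (a * c + b * d)\<^sup>2
        = (1 + p * (x1\<^sup>2 + x2\<^sup>2)) * (v1 * d - v2 * c)\<^sup>2"
      unfolding q_def a_def b_def by algebra
    then have "q\<^sup>2 = (s * (v1 * d - v2 * c))\<^sup>2"
      unfolding o n s2[symmetric] by (simp add: power2_eq_square algebra_simps)
    then have qs: "q = s * (v1 * d - v2 * c)"
      using q0 t sp by (metis power2_eq_iff_nonneg mult_nonneg_nonneg less_imp_le)
    show ?thesis
    proof (cases "q = 0")
      case True
      have nn: "p * (x1 * c + x2 * d)\<^sup>2 \<ge> 0" "p * (x1 * v1 + x2 * v2)\<^sup>2 \<ge> 0" using p0 by simp_all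
      have "c\<^sup>2 + d\<^sup>2 = 0" "v1\<^sup>2 + v2\<^sup>2 = 0"
        using n nn True sum_power2_ge_zero[of c d] sum_power2_ge_zero[of v1 v2] unfolding q_def by linarith+
      then have "c = 0" "d = 0" "v1 = 0" "v2 = 0" by (simp_all add: sum_power2_eq_zero_iff)
      then show ?thesis by (simp add: complex_eq_iff cd[symmetric] a_def b_def)
    next
      case False
      have "q * (s * c) = q * (- b)" "q * (s * d) = q * a"
        using o qs q_ab by algebra+
      then have "s * c = - b" "s * d = a" using mult_left_cancel[OF False] by blast+
      then have "c = - b / s" "d = a / s" using sp by (simp_all add: field_simps)
      then show ?thesis by (simp add: complex_eq_iff cd[symmetric])
    qed
  qed
  have nn: "0 \<le> q / s" using q0 sp by simp
  show ?thesis
    unfolding rot_def rhs using w0 w1 w2 nn uniq by (intro the_equality) auto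
qed

lemma christoffel_eq:
  assumes "0 \<le> \<kappa>"
  shows "christoffel \<kappa> x v =
    of_real ((\<kappa>\<^sup>2 * (x \<bullet> v)\<^sup>2 + (2 * \<kappa> + \<kappa>\<^sup>2 * (x \<bullet> x)) * (v \<bullet> v)) / (1 + \<kappa> * (x \<bullet> x))\<^sup>2) * x"
proof -
  define p where "p = 2 * \<kappa> + \<kappa>\<^sup>2 * (x \<bullet> x)"
  define s where "s = 1 + \<kappa> * (x \<bullet> x)"
  have p0: "p \<ge> 0" and s1: "s \<ge> 1" unfolding p_def s_def using assms by auto
  have s2: "s\<^sup>2 = 1 + p * (x \<bullet> x)"
    unfolding p_def s_def by (simp add: power2_eq_square algebra_simps)
  define e where "e = \<kappa>\<^sup>2 * (x \<bullet> v)\<^sup>2 + p * (v \<bullet> v)"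
  let ?w = "of_real (e / s\<^sup>2) * x"
  have fd: "frechet_derivative (\<lambda>y. metric \<kappa> y u h) (at x) =
      (\<lambda>k. 2 * \<kappa>\<^sup>2 * (x \<bullet> k) * (x \<bullet> u) * (x \<bullet> h) + p * ((k \<bullet> u) * (x \<bullet> h) + (x \<bullet> u) * (k \<bullet> h)))" for u h
  proof -
    have "((\<lambda>y. metric \<kappa> y u h) has_derivative
      (\<lambda>k. 2 * \<kappa>\<^sup>2 * (x \<bullet> k) * (x \<bullet> u) * (x \<bullet> h) + p * ((k \<bullet> u) * (x \<bullet> h) + (x \<bullet> u) * (k \<bullet> h)))) (at x)"
      unfolding metric_def p_def
      by (auto intro!: derivative_eq_intros simp: fun_eq_iff algebra_simps inner_commute)
    then show ?thesis by (rule frechet_derivative_at[symmetric])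
  qed
  have rhs: "frechet_derivative (\<lambda>y. metric \<kappa> y v h) (at x) v
      - frechet_derivative (\<lambda>y. metric \<kappa> y v v) (at x) h / 2 = e * (x \<bullet> h)" for h
    unfolding fd e_def by (simp add: power2_eq_square field_simps inner_commute)
  have g: "metric \<kappa> x ?w h = e * (x \<bullet> h)" for h
  proof -
    have "?w = (e / s\<^sup>2) *\<^sub>R x" by (simp add: scaleR_conv_of_real)
    then have "metric \<kappa> x ?w h = (e / s\<^sup>2) * (1 + p * (x \<bullet> x)) * (x \<bullet> h)"
      unfolding metric_def p_def[symmetric] by (simp add: algebra_simps add_divide_distrib)
    then show ?thesis unfolding s2[symmetric] using s1 by simp
  qed
  have uniq: "w = ?w" if w: "\<forall>h. metric \<kappa> x w h = e * (x \<bullet> h)" for w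
  proof -
    let ?d = "w - ?w"
    have "metric \<kappa> x ?d ?d = metric \<kappa> x w ?d - metric \<kappa> x ?w ?d"
      unfolding metric_def inner_diff_left inner_diff_right by algebra
    also have "\<dots> = 0" using w g by simp
    finally have "?d \<bullet> ?d + p * (x \<bullet> ?d)\<^sup>2 = 0"
      unfolding metric_def p_def[symmetric] by (simp add: power2_eq_square)
    moreover have "p * (x \<bullet> ?d)\<^sup>2 \<ge> 0" using p0 by simp
    ultimately have "?d \<bullet> ?d \<le> 0" by linarith
    then show ?thesis by (metis inner_gt_zero_iff not_le right_minus_eq)
  qed
  show ?thesis
    unfolding christoffel_def rhs p_def[symmetric] s_def[symmetric] e_def[symmetric]
    using g uniq by (intro the_equality) auto
qed

definition SM :: "real \<Rightarrow> real \<Rightarrow> (complex \<times> complex) set" where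
  "SM R \<kappa> = {(x, v). norm x \<le> R \<and> metric \<kappa> x v v = 1}"

definition BM :: "real \<Rightarrow> real \<Rightarrow> (complex \<times> complex) set" where
  "BM R \<kappa> = {(x, v). norm x \<le> R \<and> metric \<kappa> x v v \<le> 1}"

text \<open>
  The generators \<open>X\<close> of the geodesic flow and \<open>V\<close> of the circle action, as vector fields on the
  tangent bundle of the plane. Both are tangent to the unit tangent bundle, hence so is
  their bracket.
\<close>

definition geodesic_field :: "real \<Rightarrow> complex \<times> complex \<Rightarrow> complex \<times> complex" where
  "geodesic_field \<kappa> = (\<lambda>(x, v). (v, - christoffel \<kappa> x v))"

definition circle_field :: "real \<Rightarrow> complex \<times> complex \<Rightarrow> complex \<times> complex" where
  "circle_field \<kappa> = (\<lambda>(x, v). (0, rot \<kappa> x v))"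

definition Omega :: "real \<Rightarrow> real \<Rightarrow> int \<Rightarrow> (complex \<times> complex \<Rightarrow> complex) set" where
  "Omega R \<kappa> k = {f. has_lie_derivative_on (SM R \<kappa>) (circle_field \<kappa>) f (\<lambda>p. \<i> * of_int k * f p)}"

text \<open>
  \<open>u = \<Sum>k\<in>K. c\<^sub>k\<close> on \<open>SM\<close> with \<open>c\<^sub>k \<in> \<Omega>\<^sub>k\<close>. Pointwise unconditional convergence is enough to
  determine the modes, and it holds for smooth \<open>u\<close> and \<open>K = UNIV\<close>.
\<close>

definition fourier_decomposition ::
    "real \<Rightarrow> real \<Rightarrow> int set \<Rightarrow> (complex \<times> complex \<Rightarrow> complex) \<Rightarrow> (int \<Rightarrow> complex \<times> complex \<Rightarrow> complex) \<Rightarrow> bool" where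
  "fourier_decomposition R \<kappa> K u c \<longleftrightarrow>
     (\<forall>k\<in>K. c k \<in> Omega R \<kappa> k) \<and> (\<forall>p\<in>SM R \<kappa>. ((\<lambda>k. c k p) has_sum u p) K)"

definition fourier_mode ::
    "real \<Rightarrow> real \<Rightarrow> int \<Rightarrow> (complex \<times> complex \<Rightarrow> complex) \<Rightarrow> complex \<times> complex \<Rightarrow> complex" where
  "fourier_mode R \<kappa> k u p = (THE y. \<exists>c. fourier_decomposition R \<kappa> UNIV u c \<and> c k p = y)"

text \<open>\<open>\<eta>\<^sub>\<plusminus> = (X \<plusminus> \<i> [X, V]) / 2\<close>, as complexified vector fields.\<close>

definition eta_plus :: "real \<Rightarrow> complex \<times> complex \<Rightarrow> (complex \<times> complex) \<times> (complex \<times> complex)" where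
  "eta_plus \<kappa> p = cscale (1/2)
     (geodesic_field \<kappa> p, lie_bracket (geodesic_field \<kappa>) (circle_field \<kappa>) p)"

definition eta_minus :: "real \<Rightarrow> complex \<times> complex \<Rightarrow> (complex \<times> complex) \<times> (complex \<times> complex)" where
  "eta_minus \<kappa> p = cscale (1/2)
     (geodesic_field \<kappa> p, - lie_bracket (geodesic_field \<kappa>) (circle_field \<kappa>) p)"

definition twistor_map :: "real \<Rightarrow> (complex \<times> complex) \<times> complex \<Rightarrow> complex \<times> complex" where
  "twistor_map \<kappa> = (\<lambda>((x, v), \<omega>). (x, act \<kappa> x \<omega> v))"

text \<open>
  The generators \<open>\<eta>\<^sub>- + \<omega>\<^sup>2 \<eta>\<^sub>+\<close> and \<open>\<partial> / \<partial>(cnj \<omega>) = (\<partial> / \<partial>(Re \<omega>) + \<i> \<partial> / \<partial>(Im \<omega>)) / 2\<close> on the product of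
  \<open>SM\<close> and the disk.
\<close>

definition twistor_eta ::
    "real \<Rightarrow> (complex \<times> complex) \<times> complex \<Rightarrow> ((complex \<times> complex) \<times> complex) \<times> ((complex \<times> complex) \<times> complex)" where
  "twistor_eta \<kappa> = (\<lambda>(p, \<omega>). map_prod (\<lambda>\<xi>. (\<xi>, 0)) (\<lambda>\<xi>. (\<xi>, 0))
     (eta_minus \<kappa> p + cscale (\<omega>\<^sup>2) (eta_plus \<kappa> p)))"

definition twistor_dbar ::
    "((complex \<times> complex) \<times> complex) \<times> ((complex \<times> complex) \<times> complex)" where
  "twistor_dbar = cscale (1/2) ((0, 1), (0, \<i>))"

definition twistor_distribution ::
    "real \<Rightarrow> real \<Rightarrow> complex \<times> complex \<Rightarrow> ((complex \<times> complex) \<times> (complex \<times> complex)) set" where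
  "twistor_distribution R \<kappa> q =
     {map_prod L L (cscale \<alpha> (twistor_eta \<kappa> (p, \<omega>)) + cscale \<beta> twistor_dbar) | p \<omega> \<alpha> \<beta> L.
        p \<in> SM R \<kappa> \<and> norm \<omega> \<le> 1 \<and> twistor_map \<kappa> (p, \<omega>) = q
        \<and> L = frechet_derivative (twistor_map \<kappa>) (at (p, \<omega>))}"

definition twistor_holomorphic :: "real \<Rightarrow> real \<Rightarrow> (complex \<times> complex \<Rightarrow> complex) set" where
  "twistor_holomorphic R \<kappa> = {f. \<exists>U F. smooth_extension (BM R \<kappa>) f U F \<and>
     (\<forall>q\<in>BM R \<kappa>. \<forall>\<xi>\<in>twistor_distribution R \<kappa> q. capply (frechet_derivative F (at q)) \<xi> = 0)}"

definition twistor_holomorphic_ge :: "real \<Rightarrow> real \<Rightarrow> int \<Rightarrow> (complex \<times> complex \<Rightarrow> complex) set" where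
  "twistor_holomorphic_ge R \<kappa> m =
     {f \<in> twistor_holomorphic R \<kappa>. \<exists>c. fourier_decomposition R \<kappa> {m..} f c}"

text \<open>
  The complex structure is given by the rotation; a chart is an injective solution of the
  Cauchy-Riemann equations.
\<close>

definition cauchy_riemann_on :: "real \<Rightarrow> complex set \<Rightarrow> (complex \<Rightarrow> complex) \<Rightarrow> bool" where
  "cauchy_riemann_on \<kappa> U w \<longleftrightarrow> (\<forall>x\<in>U. w differentiable (at x) \<and>
     (\<forall>v. frechet_derivative w (at x) (rot \<kappa> x v) = \<i> * frechet_derivative w (at x) v))"

definition holomorphic_chart :: "real \<Rightarrow> complex set \<Rightarrow> (complex \<Rightarrow> complex) \<Rightarrow> bool" where
  "holomorphic_chart \<kappa> U w \<longleftrightarrow> open U \<and> cauchy_riemann_on \<kappa> U w \<and> inj_on w U"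

text \<open>
  \<open>v \<mapsto> (v - \<i> \<iota> v) / 2\<close> identifies the tangent space, with complex structure \<open>\<iota>\<close>, with \<open>T\<^sup>1\<^sup>,\<^sup>0\<close>.
  An element of the \<open>m\<close>-fold tensor power of the dual of \<open>T\<^sup>1\<^sup>,\<^sup>0\<close> is accordingly a map on lists of
  \<open>m\<close> tangent vectors that is complex linear in each entry.
\<close>

definition tensor_section :: "real \<Rightarrow> real \<Rightarrow> nat \<Rightarrow> (complex \<Rightarrow> complex list \<Rightarrow> complex) \<Rightarrow> bool" where
  "tensor_section R \<kappa> m a \<longleftrightarrow>
     (\<forall>x\<in>cball 0 R. \<forall>vs i \<omega> v w. length vs = m \<and> i < m \<longrightarrow>
        a x (vs[i := act \<kappa> x \<omega> v + w]) = \<omega> * a x (vs[i := v]) + a x (vs[i := w])) \<and>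
     (\<forall>vs. length vs = m \<longrightarrow> smooth_on (cball 0 R) (\<lambda>x. a x vs))"

text \<open>\<open>a = A dw\<^sup>m\<close> on \<open>S\<close>, where \<open>A\<close> is a function of the point, not of \<open>w\<close>.\<close>

definition has_coefficient ::
    "complex set \<Rightarrow> nat \<Rightarrow> (complex \<Rightarrow> complex list \<Rightarrow> complex) \<Rightarrow> (complex \<Rightarrow> complex) \<Rightarrow> (complex \<Rightarrow> complex) \<Rightarrow> bool" where
  "has_coefficient S m a w A \<longleftrightarrow>
     (\<forall>x\<in>S. \<forall>vs. length vs = m \<longrightarrow> a x vs = A x * (\<Prod>v\<leftarrow>vs. frechet_derivative w (at x) v))"

text \<open>
  The Cauchy-Riemann operator sends \<open>A dw\<^sup>m\<close> to \<open>\<partial>A / \<partial>(cnj w) d(cnj w) \<otimes> dw\<^sup>m\<close> in a holomorphic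
  coordinate \<open>w\<close>. By continuity it vanishes if it does in the interior.
\<close>

definition dbar_closed :: "real \<Rightarrow> real \<Rightarrow> nat \<Rightarrow> (complex \<Rightarrow> complex list \<Rightarrow> complex) \<Rightarrow> bool" where
  "dbar_closed R \<kappa> m a \<longleftrightarrow>
     (\<forall>U w A. holomorphic_chart \<kappa> U w \<and> U \<subseteq> ball 0 R \<and> has_coefficient U m a w A
        \<longrightarrow> cauchy_riemann_on \<kappa> U A)"

definition holomorphic_differentials ::
    "real \<Rightarrow> real \<Rightarrow> nat \<Rightarrow> (complex \<Rightarrow> complex list \<Rightarrow> complex) set" where
  "holomorphic_differentials R \<kappa> m = {a. tensor_section R \<kappa> m a \<and> dbar_closed R \<kappa> m a}"

definition associated :: "nat \<Rightarrow> (complex \<Rightarrow> complex list \<Rightarrow> complex) \<Rightarrow> complex \<times> complex \<Rightarrow> complex" where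
  "associated m a = (\<lambda>(x, v). a x (replicate m v))"

text \<open>
  The graph of \<open>\<pi>\<^sub>m\<^sub>*\<close>: the differential \<open>a\<close> corresponds to the \<open>m\<close>-th Fourier mode of \<open>f\<close> on \<open>SM\<close>.
\<close>

definition has_pushforward ::
    "real \<Rightarrow> real \<Rightarrow> nat \<Rightarrow> (complex \<times> complex \<Rightarrow> complex) \<Rightarrow> (complex \<Rightarrow> complex list \<Rightarrow> complex) \<Rightarrow> bool" where
  "has_pushforward R \<kappa> m f a \<longleftrightarrow> a \<in> holomorphic_differentials R \<kappa> m \<and>
     (\<forall>p\<in>SM R \<kappa>. associated m a p = fourier_mode R \<kappa> (int m) f p)"

definition zeta :: "real \<Rightarrow> complex \<Rightarrow> complex" where
  "zeta \<kappa> z = z * exp (of_real \<kappa> * z * cnj z / 2)"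

text \<open>
  \<open>a = A(\<zeta>) d\<zeta>\<^sup>m\<close>, where \<open>A\<close> is the sum of a power series with coefficients \<open>c\<close> that has radius of
  convergence at least \<open>\<rho>\<close> and whose sum is smooth up to the boundary of the disk of radius \<open>\<rho>\<close>.
\<close>

definition extends_smoothly ::
    "real \<Rightarrow> real \<Rightarrow> nat \<Rightarrow> (complex \<Rightarrow> complex list \<Rightarrow> complex) \<Rightarrow> real \<Rightarrow> bool" where
  "extends_smoothly R \<kappa> m a \<rho> \<longleftrightarrow>
     (\<exists>A c. has_coefficient (cball 0 R) m a (zeta \<kappa>) (\<lambda>x. A (zeta \<kappa> x)) \<and>
        (\<forall>z\<in>ball 0 (R * exp (\<kappa> * R\<^sup>2 / 2)). (\<lambda>k. c k * z ^ k) sums A z) \<and>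
        ereal \<rho> \<le> conv_radius c \<and>
        (\<exists>B. smooth_on (cball 0 \<rho>) B \<and> (\<forall>z\<in>ball 0 \<rho>. B z = (\<Sum>k. c k * z ^ k))))"

end

theory Submission
  imports Defs "HOL-Complex_Analysis.Complex_Analysis"
begin

text \<open>
  In the frame coordinate \<open>E = v + \<kappa> (x \<bullet> v) x\<close> the differential of the holomorphic coordinate is
  \<open>d\<zeta>(v) = exp (\<kappa> |x|\<^sup>2 / 2) E\<close>, the metric norm of \<open>v\<close> is \<open>|E|\<close>, and the circle action is multiplication of
  \<open>E\<close>. If \<open>x\<close> has polar angle \<open>\<theta>\<close> and \<open>E = exp (\<i> (\<theta> + \<alpha>))\<close>, Clairaut's relation says that
  \<open>r sin \<alpha>\<close> is conserved by the geodesic flow, and integrating the geodesic equation shows that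
  \<open>\<theta> + \<alpha> - \<kappa> r\<^sup>2 sin \<alpha> cos \<alpha>\<close> is conserved too. Multiplying the exponential of \<open>\<i>\<close> times the latter by
  \<open>exp (\<kappa> (r sin \<alpha>)\<^sup>2)\<close> removes the negative Fourier modes and gives the fibrewise holomorphic
  first integrals
  \<open>w\<^sub>1 = E q\<close> and \<open>w\<^sub>0 = (x - cnj x E\<^sup>2) q\<close> with \<open>q = exp (\<kappa> |x|\<^sup>2 / 2 - \<kappa> (cnj x)\<^sup>2 E\<^sup>2 / 2)\<close>,
  whose leading modes are \<open>d\<zeta>(v)\<close> and \<open>\<zeta>\<close>. Both are twistor holomorphic, and \<open>|w\<^sub>0| \<le> 2 R exp (\<kappa> R\<^sup>2)\<close> on
  \<open>BM\<close>, so \<open>A(w\<^sub>0) w\<^sub>1\<^sup>m\<close> is defined and has leading mode \<open>A(\<zeta>) d\<zeta>\<^sup>m\<close>.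
\<close>

section \<open>Functions of class $C^k$\<close>

text \<open>Because \<open>U\<close> is open, the germ at each point of \<open>U\<close>, and with
  it every iterated \<open>frechet_derivative\<close>, is determined by the values on
  \<open>U\<close>.\<close>

lemma Ck_on_cong:
  assumes "open U" "\<And>x. x \<in> U \<Longrightarrow> f x = g x" "Ck_on k U f"
  shows "Ck_on k U g"
  using assms(2,3)
proof (induction k arbitrary: f g)
  case 0
  then show ?case by (simp cong: continuous_on_cong)
next
  case (Suc k)
  have d: "(g has_derivative frechet_derivative f (at x)) (at x)" if "x \<in> U" for x
    using Suc.prems that has_derivative_transform_within_open[OF _ \<open>open U\<close> that, of f]
    by (auto simp: frechet_derivative_works)
  have "Ck_on k U (\<lambda>x. frechet_derivative g (at x) h)" for h
    using Suc.IH[of "\<lambda>x. frechet_derivative f (at x) h"] Suc.prems(2) frechet_derivative_at[OF d]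
    by simp
  then show ?case using d by (auto simp: differentiable_def)
qed

text \<open>Lets the inductive steps work with an explicit derivative \<open>f'\<close> in place of
  the chosen term \<open>frechet_derivative f\<close>.\<close>

lemma Ck_on_SucI:
  assumes "open U" "\<And>x. x \<in> U \<Longrightarrow> (f has_derivative f' x) (at x)" "\<And>h. Ck_on k U (\<lambda>x. f' x h)"
  shows "Ck_on (Suc k) U f"
  using assms Ck_on_cong[OF assms(1) _ assms(3)] frechet_derivative_at[OF assms(2)]
  by (auto simp: differentiable_def)

lemma Ck_on_Suc_has_derivative:
  assumes "Ck_on (Suc k) U f" "x \<in> U"
  shows "(f has_derivative frechet_derivative f (at x)) (at x)"
  using assms by (simp add: frechet_derivative_works)

lemma Ck_on_Suc_deriv: "Ck_on (Suc k) U f \<Longrightarrow> Ck_on k U (\<lambda>x. frechet_derivative f (at x) h)"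
  by simp

lemma Ck_on_SucD: "Ck_on (Suc k) U f \<Longrightarrow> Ck_on k U f"
proof (induction k arbitrary: f)
  case 0
  then show ?case
    by (auto intro!: continuous_at_imp_continuous_on differentiable_imp_continuous_within)
qed auto

lemma Ck_on_subset: "Ck_on k U f \<Longrightarrow> V \<subseteq> U \<Longrightarrow> Ck_on k V f"
  by (induction k arbitrary: f) (auto intro: continuous_on_subset)

lemma Ck_on_imp_continuous_on: "Ck_on k U f \<Longrightarrow> continuous_on U f"
  by (induction k) (auto dest: Ck_on_SucD simp del: Ck_on.simps(2))

lemma Ck_on_const [simp]: "Ck_on k U (\<lambda>x. c)"
  by (induction k arbitrary: c) simp_all

lemma Ck_on_bounded_linear:
  assumes "bounded_linear L"
  shows "Ck_on k U L"
proof (cases k)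
  case 0
  then show ?thesis by (simp add: assms linear_continuous_on)
next
  case (Suc j)
  have d: "(L has_derivative L) (at x)" for x
    by (rule bounded_linear_imp_has_derivative[OF assms])
  show ?thesis
    using Suc d by (auto simp: differentiable_def frechet_derivative_at[OF d, symmetric])
qed

lemma Ck_on_add:
  assumes "open U" "Ck_on k U f" "Ck_on k U g"
  shows "Ck_on k U (\<lambda>x. f x + g x)"
  using assms(2,3)
proof (induction k arbitrary: f g)
  case (Suc k)
  show ?case
    by (rule Ck_on_SucI[OF \<open>open U\<close> has_derivative_add]; (rule Ck_on_Suc_has_derivative Suc)?)
      (auto intro!: Suc.IH Ck_on_Suc_deriv[OF Suc.prems(1)] Ck_on_Suc_deriv[OF Suc.prems(2)] Suc.prems
        simp del: Ck_on.simps)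
qed (simp add: continuous_on_add)

lemma Ck_on_sum:
  assumes "open U" "\<And>i. i \<in> I \<Longrightarrow> Ck_on k U (f i)"
  shows "Ck_on k U (\<lambda>x. \<Sum>i\<in>I. f i x)"
  using assms(2) by (induction I rule: infinite_finite_induct) (auto intro: Ck_on_add[OF assms(1)])

text \<open>By the product rule a directional derivative is a sum of two terms of the same bilinear
  shape. The undifferentiated factors lose one order, which is what \<open>Ck_on_SucD\<close>
  supplies.\<close>

lemma Ck_on_bilinear:
  assumes "bounded_bilinear B" "open U" "Ck_on k U f" "Ck_on k U g"
  shows "Ck_on k U (\<lambda>x. B (f x) (g x))"
  using assms(3,4)
proof (induction k arbitrary: f g)
  case (Suc k)
  note d = Ck_on_Suc_deriv[OF Suc.prems(1)] Ck_on_Suc_deriv[OF Suc.prems(2)]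
  show ?case
    by (rule Ck_on_SucI[OF \<open>open U\<close>
          bounded_bilinear.FDERIV[OF assms(1) Ck_on_Suc_has_derivative[OF Suc.prems(1)] Ck_on_Suc_has_derivative[OF Suc.prems(2)]]])
      (auto intro!: Suc.IH Ck_on_add \<open>open U\<close> d Suc.prems[THEN Ck_on_SucD] simp del: Ck_on.simps)
qed (simp add: bounded_bilinear.continuous_on[OF assms(1)])

lemmas Ck_on_mult = Ck_on_bilinear[OF bounded_bilinear_mult]
lemmas Ck_on_scaleR = Ck_on_bilinear[OF bounded_bilinear_scaleR]
lemmas Ck_on_inner = Ck_on_bilinear[OF bounded_bilinear_inner]

lemma Ck_on_power:
  fixes f :: "'a::real_normed_vector \<Rightarrow> 'b::real_normed_algebra_1"
  assumes "open U" "Ck_on k U f"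
  shows "Ck_on k U (\<lambda>x. f x ^ n)"
  by (induction n) (simp_all add: Ck_on_mult assms)

lemma Ck_on_Pair:
  assumes "open U" "Ck_on k U f" "Ck_on k U g"
  shows "Ck_on k U (\<lambda>x. (f x, g x))"
  using assms(2,3)
proof (induction k arbitrary: f g)
  case (Suc k)
  show ?case
    by (rule Ck_on_SucI[OF assms(1) has_derivative_Pair[OF Ck_on_Suc_has_derivative[OF Suc.prems(1)]
            Ck_on_Suc_has_derivative[OF Suc.prems(2)]]])
      (auto intro!: Suc.IH Ck_on_Suc_deriv[OF Suc.prems(1)] Ck_on_Suc_deriv[OF Suc.prems(2)] simp del: Ck_on.simps)
qed (simp add: continuous_on_Pair)

lemma Ck_on_diff:
  assumes "open U" "Ck_on k U f" "Ck_on k U g"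
  shows "Ck_on k U (\<lambda>x. f x - g x)"
  using Ck_on_add[OF assms(1,2) Ck_on_scaleR[OF assms(1) Ck_on_const[of k U "-1"] assms(3)]] by simp

text \<open>\<open>Ck_on\<close> controls derivatives along fixed vectors only, whereas the chain
  rule differentiates \<open>f\<close> along a direction that moves with \<open>x\<close>. Expanding
  this direction in a finite basis reduces to fixed vectors with coefficients depending on
  \<open>x\<close>.\<close>

lemma Ck_on_compose:
  fixes f :: "'b::euclidean_space \<Rightarrow> 'c::real_normed_vector"
  assumes "open U" "open V" "g ` V \<subseteq> U" "Ck_on k U f" "Ck_on k V g"
  shows "Ck_on k V (\<lambda>x. f (g x))"
  using assms(4,5)
proof (induction k arbitrary: f)
  case 0
  then show ?case using assms(3) by (auto intro: continuous_on_compose2)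
next
  case (Suc k)
  let ?f' = "\<lambda>y. frechet_derivative f (at y)" and ?g' = "\<lambda>x. frechet_derivative g (at x)"
  have d: "((\<lambda>x. f (g x)) has_derivative (\<lambda>h. \<Sum>b\<in>Basis. (?g' x h \<bullet> b) *\<^sub>R ?f' (g x) b)) (at x)"
    if "x \<in> V" for x
  proof -
    have f: "(f has_derivative ?f' (g x)) (at (g x))"
      using Ck_on_Suc_has_derivative[OF Suc.prems(1)] that assms(3) by auto
    then interpret bounded_linear "?f' (g x)" by (rule has_derivative_bounded_linear)
    have "?f' (g x) (?g' x h) = (\<Sum>b\<in>Basis. (?g' x h \<bullet> b) *\<^sub>R ?f' (g x) b)" for h
      by (subst euclidean_representation[of "?g' x h", symmetric]) (simp only: sum scaleR)
    then show ?thesis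
      using has_derivative_compose[OF Ck_on_Suc_has_derivative[OF Suc.prems(2) that] f] by simp
  qed
  show ?case
    by (rule Ck_on_SucI[OF assms(2) d])
      (auto intro!: Ck_on_sum Ck_on_scaleR Ck_on_inner Suc.IH assms(2)
        Ck_on_Suc_deriv[OF Suc.prems(1)] Ck_on_Suc_deriv[OF Suc.prems(2)]
        Ck_on_SucD[OF Suc.prems(2)] simp del: Ck_on.simps)
qed

lemma Ck_on_exp: "Ck_on k UNIV (exp :: complex \<Rightarrow> complex)"
proof (induction k)
  case (Suc k)
  have "((exp :: complex \<Rightarrow> complex) has_derivative (\<lambda>h. exp x * h)) (at x)" for x
    using DERIV_exp[of x] by (simp add: has_field_derivative_def)
  then show ?case
    by (rule Ck_on_SucI[rotated]) (auto intro!: Ck_on_mult Suc)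
qed (simp add: continuous_on_exp continuous_on_id)

section \<open>Pointwise consequences of having a smooth extension\<close>

lemma smooth_extension_differentiable:
  assumes "smooth_extension S f U F" "x \<in> S"
  shows "(F has_derivative frechet_derivative F (at x)) (at x)"
proof -
  have "Ck_on (Suc 0) U F" "x \<in> U"
    using assms unfolding smooth_extension_def by blast+
  then show ?thesis by (rule Ck_on_Suc_has_derivative)
qed

lemma smooth_on_imp_continuous_on:
  assumes "smooth_on S f"
  shows "continuous_on S f"
proof -
  obtain U F where UF: "smooth_extension S f U F" using assms unfolding smooth_on_def by blast
  then have "continuous_on S F"
    unfolding smooth_extension_def by (meson Ck_on_imp_continuous_on continuous_on_subset)
  then show ?thesis using UF unfolding smooth_extension_def by (simp cong: continuous_on_cong)
qed

section \<open>The frame coordinate and the geodesic flow\<close>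

text \<open>For nonnegative \<open>\<kappa>\<close> this applies the positive symmetric square root
  of the Gram matrix of the metric: eigenvalue \<open>1 + \<kappa> * r\<^sup>2\<close> radially and
  1 in the angular direction. It carries the metric to the Euclidean one.\<close>

definition frame_coord :: "real \<Rightarrow> complex \<Rightarrow> complex \<Rightarrow> complex" where
  "frame_coord \<kappa> x v = v + of_real (\<kappa> * (x \<bullet> v)) * x"

text \<open>Inverse of \<open>frame_coord\<close>, by \<open>x \<bullet> frame_coord \<kappa> x v = (1 + \<kappa> (x \<bullet> x)) (x \<bullet> v)\<close>.\<close>

definition frame_vec :: "real \<Rightarrow> complex \<Rightarrow> complex \<Rightarrow> complex" where
  "frame_vec \<kappa> x e = e - of_real (\<kappa> * (x \<bullet> e) / (1 + \<kappa> * (x \<bullet> x))) * x"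

lemma conformal_factor_pos: "0 \<le> \<kappa> \<Longrightarrow> 0 < 1 + \<kappa> * (x \<bullet> (x::complex))"
  by (simp add: add_pos_nonneg)

lemma inner_of_real_mult: "(x::complex) \<bullet> (of_real c * y) = c * (x \<bullet> y)"
  by (simp add: scaleR_conv_of_real[symmetric])

lemma frame_coord_vec [simp]:
  assumes "0 \<le> \<kappa>"
  shows "frame_coord \<kappa> x (frame_vec \<kappa> x e) = e"
proof -
  let ?s = "1 + \<kappa> * (x \<bullet> x)"
  have "?s \<noteq> 0" using conformal_factor_pos[OF assms] by (metis less_irrefl)
  then have "\<kappa> * (x \<bullet> frame_vec \<kappa> x e) = \<kappa> * (x \<bullet> e) / ?s"
    unfolding frame_vec_def inner_diff_right inner_of_real_mult by (simp add: field_simps)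
  then show ?thesis unfolding frame_coord_def by (simp add: frame_vec_def)
qed

lemma frame_vec_coord [simp]:
  assumes "0 \<le> \<kappa>"
  shows "frame_vec \<kappa> x (frame_coord \<kappa> x v) = v"
proof -
  let ?s = "1 + \<kappa> * (x \<bullet> x)"
  have "?s \<noteq> 0" using conformal_factor_pos[OF assms] by (metis less_irrefl)
  then have "\<kappa> * (x \<bullet> frame_coord \<kappa> x v) / ?s = \<kappa> * (x \<bullet> v)"
    unfolding frame_coord_def inner_add_right inner_of_real_mult by (simp add: field_simps)
  then show ?thesis unfolding frame_vec_def by (simp add: frame_coord_def)
qed

lemma metric_eq_norm_frame_coord: "metric \<kappa> x v v = (norm (frame_coord \<kappa> x v))\<^sup>2"
  unfolding power2_norm_eq_inner metric_def frame_coord_def inner_add_left inner_add_right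
    inner_of_real_mult inner_commute[of "of_real _ * _"]
  by (simp add: inner_commute power2_eq_square algebra_simps)

lemma rot_eq_frame:
  assumes "0 \<le> \<kappa>"
  shows "rot \<kappa> x v = frame_vec \<kappa> x (\<i> * frame_coord \<kappa> x v)"
proof -
  obtain x1 x2 v1 v2 where e: "x = Complex x1 x2" "v = Complex v1 v2" by (metis complex.exhaust)
  define s where "s = 1 + \<kappa> * (x1\<^sup>2 + x2\<^sup>2)"
  have s: "s \<noteq> 0" using conformal_factor_pos[OF assms, of x]
    by (auto simp: s_def e inner_complex_def power2_eq_square)
  have "1 + \<kappa> * (x \<bullet> x) = s" by (simp add: s_def e inner_complex_def power2_eq_square)
  then show ?thesis
    unfolding rot_eq[OF assms] frame_vec_def frame_coord_def
    using s by (simp add: e inner_complex_def complex_eq_iff Re_divide_of_real Im_divide_of_real field_simps)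
      (simp add: s_def power2_eq_square algebra_simps)
qed

lemma frame_coord_rot: "0 \<le> \<kappa> \<Longrightarrow> frame_coord \<kappa> x (rot \<kappa> x v) = \<i> * frame_coord \<kappa> x v"
  by (simp add: rot_eq_frame)

lemma bounded_linear_frame_coord: "bounded_linear (frame_coord \<kappa> x)"
  unfolding frame_coord_def
  by (intro bounded_linear_add bounded_linear_ident bounded_linear_mult_const
      bounded_linear_of_real[THEN bounded_linear_compose] bounded_linear_const_mult bounded_linear_inner_right)

lemma bounded_linear_frame_vec: "bounded_linear (frame_vec \<kappa> x)"
  unfolding frame_vec_def divide_inverse
  by (intro bounded_linear_sub bounded_linear_ident bounded_linear_mult_const
      bounded_linear_of_real[THEN bounded_linear_compose] bounded_linear_const_mult bounded_linear_inner_right)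

lemma frame_coord_act:
  assumes "0 \<le> \<kappa>"
  shows "frame_coord \<kappa> x (act \<kappa> x \<omega> v) = \<omega> * frame_coord \<kappa> x v"
proof -
  interpret bounded_linear "frame_coord \<kappa> x" by (rule bounded_linear_frame_coord)
  have "frame_coord \<kappa> x (act \<kappa> x \<omega> v) = (of_real (Re \<omega>) + \<i> * of_real (Im \<omega>)) * frame_coord \<kappa> x v"
    unfolding act_def add scaleR frame_coord_rot[OF assms] by (simp add: scaleR_conv_of_real algebra_simps)
  then show ?thesis by (simp add: complex_eq[symmetric])
qed

section \<open>The geodesic field and its bracket with the circle field, in the frame
  coordinate\<close>

definition d_frame_coord :: "real \<Rightarrow> complex \<times> complex \<Rightarrow> complex \<times> complex \<Rightarrow> complex" where
  "d_frame_coord \<kappa> p h = frame_coord \<kappa> (fst p) (snd h) + of_real (\<kappa> * (fst h \<bullet> snd p)) * fst p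
     + of_real (\<kappa> * (fst p \<bullet> snd p)) * fst h"

lemma has_derivative_frame_coord [derivative_intros]:
  assumes "(f has_derivative f') (at x within S)" "(g has_derivative g') (at x within S)"
  shows "((\<lambda>t. frame_coord \<kappa> (f t) (g t)) has_derivative (\<lambda>h. d_frame_coord \<kappa> (f x, g x) (f' h, g' h))) (at x within S)"
  unfolding frame_coord_def d_frame_coord_def
  by (auto intro!: derivative_eq_intros assms simp: algebra_simps)

text \<open>The derivative is a real multiple of \<open>\<i> * E\<close>: the flow preserves the
  length of the frame coordinate and only turns it. The Christoffel term is radial, so everything
  reduces to combinations of \<open>x\<close> and \<open>v\<close>.\<close>

lemma geodesic_field_frame:
  assumes "0 \<le> \<kappa>"
  defines "E x v \<equiv> frame_coord \<kappa> x v"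
  shows "d_frame_coord \<kappa> (x, v) (geodesic_field \<kappa> (x, v))
    = \<i> * of_real \<kappa> * E x v * of_real (Im (cnj x * E x v) / (1 + \<kappa> * (x \<bullet> x)))"
proof -
  define a n q b where "a = x \<bullet> v" and "n = x \<bullet> x" and "q = v \<bullet> v" and "b = Im (cnj x * v)"
  define s where "s = 1 + \<kappa> * n"
  have s: "s \<noteq> 0" using conformal_factor_pos[OF assms(1), of x] by (auto simp: s_def n_def)
  \<comment> \<open>From \<open>cnj x * v = a + \<i> * b\<close>, multiplied by \<open>x\<close>,
    and from its conjugate, multiplied by \<open>v\<close>. These eliminate the rotation by
    \<open>\<i>\<close> in favour of \<open>x\<close> and \<open>v\<close>.\<close>
  have bx: "\<i> * of_real b * x = of_real n * v - of_real a * x"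
    and bv: "\<i> * of_real b * v = of_real a * v - of_real q * x"
    by (simp_all add: a_def n_def q_def b_def inner_complex_def complex_eq_iff power2_eq_square algebra_simps)
  have ImE: "Im (cnj x * E x v) = b"
    by (simp add: E_def frame_coord_def b_def algebra_simps)
  define g where "g = (\<kappa>\<^sup>2 * a\<^sup>2 + (2 * \<kappa> + \<kappa>\<^sup>2 * n) * q) / s"
  have c: "christoffel \<kappa> x v = of_real (g / s) * x"
    unfolding christoffel_eq[OF assms(1)] g_def s_def a_def n_def q_def by (simp add: power2_eq_square)
  have "frame_coord \<kappa> x (of_real t * x) = of_real (t * s) * x" for t
    unfolding frame_coord_def inner_of_real_mult s_def n_def by (simp add: algebra_simps)
  from this[of "g / s"]
  have "frame_coord \<kappa> x (- (of_real (g / s) * x)) = - of_real g * x"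
    using s linear_neg[OF bounded_linear.linear[OF bounded_linear_frame_coord]] by simp
  then have "d_frame_coord \<kappa> (x, v) (geodesic_field \<kappa> (x, v))
      = - of_real g * x + of_real (\<kappa> * q) * x + of_real (\<kappa> * a) * v"
    unfolding geodesic_field_def d_frame_coord_def split c fst_conv snd_conv a_def q_def by simp
  \<comment> \<open>Splits off the part of the Christoffel term that cancels against
    \<open>\<kappa> * q\<close> from the motion of the base point.\<close>
  also have "- g = - \<kappa> * q - \<kappa> * (q + \<kappa> * a\<^sup>2) / s"
    unfolding g_def using s by (simp add: field_simps) (simp add: s_def power2_eq_square algebra_simps)
  then have "- of_real g * x = - of_real (\<kappa> * q) * x - of_real (\<kappa> / s) * (of_real q + of_real (\<kappa> * a\<^sup>2)) * x"
    by (simp flip: of_real_minus) (simp add: algebra_simps add_divide_distrib)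
  also have "\<dots> + of_real (\<kappa> * q) * x + of_real (\<kappa> * a) * v
      = of_real (\<kappa> / s) * (of_real (s * a) * v - of_real q * x - of_real (\<kappa> * a\<^sup>2) * x)"
    using s by (simp add: field_simps)
  also have "of_real (s * a) * v - of_real q * x - of_real (\<kappa> * a\<^sup>2) * x = \<i> * of_real b * E x v"
    using bx bv unfolding E_def frame_coord_def s_def a_def[symmetric] of_real_add of_real_mult of_real_1 of_real_power
    by algebra
  finally show ?thesis unfolding ImE n_def[symmetric] s_def[symmetric] by (simp add: field_simps)
qed

lemma geodesic_field_differentiable:
  assumes "0 \<le> \<kappa>"
  shows "geodesic_field \<kappa> differentiable (at p)"
proof -
  have "1 + \<kappa> * (fst p \<bullet> fst p) \<noteq> 0" using conformal_factor_pos[OF assms] by (metis less_irrefl)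
  then show ?thesis
    unfolding differentiable_def geodesic_field_def christoffel_eq[OF assms] case_prod_unfold
    by (intro exI) (rule derivative_eq_intros refl | simp)+
qed

lemma rot_differentiable:
  assumes "0 \<le> \<kappa>"
  shows "(\<lambda>p. rot \<kappa> (fst p) (snd p)) differentiable (at p)"
proof -
  have "1 + \<kappa> * (fst p \<bullet> fst p) \<noteq> 0" using conformal_factor_pos[OF assms] by (metis less_irrefl)
  then have "of_real (1 + \<kappa> * (fst p \<bullet> fst p)) \<noteq> (0::complex)" by (simp only: of_real_eq_0_iff not_False_eq_True)
  then show ?thesis
    unfolding differentiable_def rot_eq[OF assms]
    by (intro exI) (rule derivative_eq_intros refl | assumption)+
qed

lemma d_frame_coord_vertical [simp]: "d_frame_coord \<kappa> p (0, h) = frame_coord \<kappa> (fst p) h"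
  by (simp add: d_frame_coord_def)

text \<open>No formula for the derivatives of \<open>rot\<close> or \<open>christoffel\<close> is
  used. The frame identities for both fields are differentiated, each in two ways, and uniqueness of
  derivatives yields the frame components of \<open>r'\<close> and \<open>X'\<close>.\<close>

lemma lie_bracket_frame:
  assumes "0 \<le> \<kappa>"
  shows "fst (lie_bracket (geodesic_field \<kappa>) (circle_field \<kappa>) p) = - rot \<kappa> (fst p) (snd p)"
    and "d_frame_coord \<kappa> p (lie_bracket (geodesic_field \<kappa>) (circle_field \<kappa>) p)
      = - \<i> * of_real \<kappa> * frame_coord \<kappa> (fst p) (snd p)
        * of_real (Re (cnj (fst p) * frame_coord \<kappa> (fst p) (snd p)) / (1 + \<kappa> * (fst p \<bullet> fst p)))"
proof -
  obtain x v where p: "p = (x, v)" by fastforce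
  define r where "r = (\<lambda>p. rot \<kappa> (fst p) (snd p))"
  define r' where "r' = frechet_derivative r (at p)"
  define X' where "X' = frechet_derivative (geodesic_field \<kappa>) (at p)"
  define E where "E = frame_coord \<kappa> x v"
  define c where "c = \<kappa> / (1 + \<kappa> * (x \<bullet> x))"
  have r: "(r has_derivative r') (at p)"
    using rot_differentiable[OF assms] unfolding r'_def r_def frechet_derivative_works .
  have X: "(geodesic_field \<kappa> has_derivative X') (at p)"
    using geodesic_field_differentiable[OF assms] unfolding X'_def frechet_derivative_works .
  have "(circle_field \<kappa> has_derivative (\<lambda>h. (0, r' h))) (at p)"
    unfolding circle_field_def case_prod_unfold r_def[symmetric]
    by (auto intro!: derivative_eq_intros r simp: r_def[symmetric])
  then have br: "lie_bracket (geodesic_field \<kappa>) (circle_field \<kappa>) p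
      = (0, r' (geodesic_field \<kappa> p)) - X' (0, r p)"
    unfolding lie_bracket_def X'_def
    by (subst frechet_derivative_at[symmetric]) (auto simp: circle_field_def r_def p)
  have fst_X': "fst (X' h) = snd h" for h
  proof -
    have "(\<lambda>p. fst (geodesic_field \<kappa> p)) = snd" by (auto simp: geodesic_field_def)
    then have "(snd has_derivative (\<lambda>h. fst (X' h))) (at p)"
      using has_derivative_fst[OF X] by simp
    then show ?thesis
      using has_derivative_unique[OF _ has_derivative_snd[OF has_derivative_ident]] by metis
  qed
  have fst_br: "fst (lie_bracket (geodesic_field \<kappa>) (circle_field \<kappa>) p) = - r p"
    unfolding br by (simp add: fst_X')
  then show "fst (lie_bracket (geodesic_field \<kappa>) (circle_field \<kappa>) p) = - rot \<kappa> (fst p) (snd p)"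
    by (simp add: r_def)
  have rE: "frame_coord \<kappa> x (r p) = \<i> * E"
    by (simp add: r_def p E_def frame_coord_rot[OF assms])
  have XE: "d_frame_coord \<kappa> (x, t) (geodesic_field \<kappa> (x, t))
      = \<i> * of_real c * frame_coord \<kappa> x t * of_real (Im (cnj x * frame_coord \<kappa> x t))" for t
    unfolding geodesic_field_frame[OF assms] c_def by simp
  \<comment> \<open>Differentiates \<open>frame_coord_rot\<close> in the base and the fibre
    direction together.\<close>
  have 1: "d_frame_coord \<kappa> (x, r p) (fst h, r' h) = \<i> * d_frame_coord \<kappa> (x, v) h" for h
  proof -
    have "((\<lambda>p. frame_coord \<kappa> (fst p) (r p)) has_derivative (\<lambda>h. d_frame_coord \<kappa> (x, r p) (fst h, r' h))) (at p)"
      by (rule derivative_eq_intros r refl)+ (simp add: p)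
    moreover have "((\<lambda>p. frame_coord \<kappa> (fst p) (r p)) has_derivative (\<lambda>h. \<i> * d_frame_coord \<kappa> (x, v) h)) (at p)"
      unfolding r_def frame_coord_rot[OF assms]
      by (rule derivative_eq_intros refl)+ (simp add: p)
    ultimately show ?thesis by (rule has_derivative_unique[THEN fun_cong])
  qed
  \<comment> \<open>Differentiates \<open>geodesic_field_frame\<close> in the fibre direction only,
    since the circle field is vertical.\<close>
  have 2: "d_frame_coord \<kappa> (x, v) (X' (0, h)) + (of_real (\<kappa> * (v \<bullet> h)) * x + of_real (\<kappa> * (x \<bullet> h)) * v)
      = \<i> * of_real c * (frame_coord \<kappa> x h * of_real (Im (cnj x * E)) + E * of_real (Im (cnj x * frame_coord \<kappa> x h)))" for h
  proof -
    have d: "((\<lambda>t. geodesic_field \<kappa> (x, t)) has_derivative (\<lambda>h. X' (0, h))) (at v)"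
      by (rule has_derivative_compose[OF has_derivative_Pair[OF has_derivative_const has_derivative_ident]])
        (use X p in simp)
    have "((\<lambda>t. d_frame_coord \<kappa> (x, t) (geodesic_field \<kappa> (x, t))) has_derivative
        (\<lambda>h. d_frame_coord \<kappa> (x, v) (X' (0, h)) + (of_real (\<kappa> * (v \<bullet> h)) * x + of_real (\<kappa> * (x \<bullet> h)) * v))) (at v)"
      unfolding d_frame_coord_def frame_coord_def fst_conv snd_conv
      by (rule derivative_eq_intros d refl)+
        (rule ext, simp add: fst_X' geodesic_field_def, simp add: algebra_simps)
    moreover have "((\<lambda>t. d_frame_coord \<kappa> (x, t) (geodesic_field \<kappa> (x, t))) has_derivative
        (\<lambda>h. \<i> * of_real c * (frame_coord \<kappa> x h * of_real (Im (cnj x * E)) + E * of_real (Im (cnj x * frame_coord \<kappa> x h))))) (at v)"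
    proof -
      note e = bounded_linear_imp_has_derivative[OF bounded_linear_frame_coord]
      note im = bounded_linear_imp_has_derivative[OF bounded_linear_Im, THEN has_derivative_compose[rotated]]
      have "((\<lambda>t. Im (cnj x * frame_coord \<kappa> x t)) has_derivative (\<lambda>h. Im (cnj x * frame_coord \<kappa> x h))) (at v)"
        by (rule im has_derivative_mult_right e)+
      then show ?thesis
        unfolding XE E_def
        by (auto intro!: derivative_eq_intros e simp: algebra_simps)
    qed
    ultimately show ?thesis by (rule has_derivative_unique[THEN fun_cong])
  qed
  have lin: "linear (frame_coord \<kappa> x)"
    using bounded_linear_frame_coord bounded_linear.linear by blast
  have "d_frame_coord \<kappa> p (lie_bracket (geodesic_field \<kappa>) (circle_field \<kappa>) p)
      = d_frame_coord \<kappa> (x, r p) (fst (geodesic_field \<kappa> p), r' (geodesic_field \<kappa> p))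
        - (d_frame_coord \<kappa> (x, v) (X' (0, r p)) + (of_real (\<kappa> * (v \<bullet> r p)) * x + of_real (\<kappa> * (x \<bullet> r p)) * v))"
    unfolding br d_frame_coord_def
    by (simp add: p fst_X' geodesic_field_def linear_diff[OF lin] inner_commute)
  also have "\<dots> = - \<i> * of_real c * E * of_real (Re (cnj x * E))"
    unfolding 1 2 rE using XE[of v, folded p E_def]
    by (simp add: p E_def[symmetric]) (simp add: algebra_simps)
  finally show "d_frame_coord \<kappa> p (lie_bracket (geodesic_field \<kappa>) (circle_field \<kappa>) p)
      = - \<i> * of_real \<kappa> * frame_coord \<kappa> (fst p) (snd p)
        * of_real (Re (cnj (fst p) * frame_coord \<kappa> (fst p) (snd p)) / (1 + \<kappa> * (fst p \<bullet> fst p)))"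
    by (simp add: p E_def c_def)
qed

section \<open>The holomorphic first integrals\<close>

text \<open>This is the factor \<open>q\<close>; with the two products below, which are
  \<open>w\<^sub>1\<close> and \<open>w\<^sub>0\<close>, it is written on pairs
  \<open>(x, E)\<close>, where it is entire in the second entry. \<open>frame_chart\<close> pulls
  them back to tangent vectors.\<close>

definition weight :: "real \<Rightarrow> complex \<times> complex \<Rightarrow> complex" where
  "weight \<kappa> p = exp (of_real (\<kappa> / 2) * (fst p * cnj (fst p) - (cnj (fst p))\<^sup>2 * (snd p)\<^sup>2))"

definition dir_integral :: "real \<Rightarrow> complex \<times> complex \<Rightarrow> complex" where
  "dir_integral \<kappa> p = snd p * weight \<kappa> p"

definition pos_integral :: "real \<Rightarrow> complex \<times> complex \<Rightarrow> complex" where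
  "pos_integral \<kappa> p = (fst p - cnj (fst p) * (snd p)\<^sup>2) * weight \<kappa> p"

text \<open>
  Differentials in the arguments \<open>(dx, d(cnj x), de)\<close>, kept independent so that complexified
  vectors can be inserted.
\<close>

definition d_log_weight :: "real \<Rightarrow> complex \<times> complex \<Rightarrow> complex \<Rightarrow> complex \<Rightarrow> complex \<Rightarrow> complex" where
  "d_log_weight \<kappa> p a b c = of_real (\<kappa> / 2) * (cnj (fst p) * a + fst p * b
     - 2 * cnj (fst p) * (snd p)\<^sup>2 * b - 2 * (cnj (fst p))\<^sup>2 * snd p * c)"

definition d_dir_integral :: "real \<Rightarrow> complex \<times> complex \<Rightarrow> complex \<Rightarrow> complex \<Rightarrow> complex \<Rightarrow> complex" where
  "d_dir_integral \<kappa> p a b c = weight \<kappa> p * (c + snd p * d_log_weight \<kappa> p a b c)"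

definition d_pos_integral :: "real \<Rightarrow> complex \<times> complex \<Rightarrow> complex \<Rightarrow> complex \<Rightarrow> complex \<Rightarrow> complex" where
  "d_pos_integral \<kappa> p a b c = weight \<kappa> p * (a - (snd p)\<^sup>2 * b - 2 * cnj (fst p) * snd p * c
     + (fst p - cnj (fst p) * (snd p)\<^sup>2) * d_log_weight \<kappa> p a b c)"

lemma has_derivative_cnj [derivative_intros]:
  "(f has_derivative f') F \<Longrightarrow> ((\<lambda>x. cnj (f x)) has_derivative (\<lambda>h. cnj (f' h))) F"
  by (rule bounded_linear.has_derivative[OF bounded_linear_cnj])

lemma has_derivative_cexp:
  assumes "(f has_derivative f') (at x)"
  shows "((\<lambda>x. exp (f x :: complex)) has_derivative (\<lambda>h. exp (f x) * f' h)) (at x)"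
  using has_derivative_compose[OF assms, of exp "\<lambda>h. exp (f x) * h"] DERIV_exp[of "f x"]
  by (simp add: has_field_derivative_def)

lemma has_derivative_weight:
  "(weight \<kappa> has_derivative (\<lambda>h. weight \<kappa> p * d_log_weight \<kappa> p (fst h) (cnj (fst h)) (snd h))) (at p)"
  unfolding weight_def[abs_def] d_log_weight_def
  by (rule has_derivative_eq_rhs[OF has_derivative_cexp], (rule derivative_eq_intros refl)+)
    (simp add: algebra_simps power2_eq_square)

lemma has_derivative_dir_integral:
  "(dir_integral \<kappa> has_derivative (\<lambda>h. d_dir_integral \<kappa> p (fst h) (cnj (fst h)) (snd h))) (at p)"
  unfolding dir_integral_def[abs_def] d_dir_integral_def
  by (rule derivative_eq_intros has_derivative_weight refl)+ (simp add: algebra_simps)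

lemma has_derivative_pos_integral:
  "(pos_integral \<kappa> has_derivative (\<lambda>h. d_pos_integral \<kappa> p (fst h) (cnj (fst h)) (snd h))) (at p)"
  unfolding pos_integral_def[abs_def] d_pos_integral_def
  by (rule derivative_eq_intros has_derivative_weight refl)+ (simp add: algebra_simps power2_eq_square)

lemma linear_d_dir_integral:
  "d_dir_integral \<kappa> p (t * a + u * a') (t * b + u * b') (t * c + u * c')
    = t * d_dir_integral \<kappa> p a b c + u * d_dir_integral \<kappa> p a' b' c'"
  unfolding d_dir_integral_def d_log_weight_def by algebra

lemma linear_d_pos_integral:
  "d_pos_integral \<kappa> p (t * a + u * a') (t * b + u * b') (t * c + u * c')
    = t * d_pos_integral \<kappa> p a b c + u * d_pos_integral \<kappa> p a' b' c'"
  unfolding d_pos_integral_def d_log_weight_def by algebra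

text \<open>
  \<open>(a, b, c)\<close> is \<open>2 s (\<eta>\<^sub>- + \<omega>\<^sup>2 \<eta>\<^sub>+)\<close> applied to \<open>x\<close>, \<open>cnj x\<close> and \<open>e = \<omega> E\<close>, where \<open>E\<close> is the frame
  coordinate of a unit vector and \<open>E' = cnj E\<close>.
\<close>

lemma integrals_annihilated:
  fixes x e \<omega> :: complex
  assumes "E * E' = 1" "e = \<omega> * E" "s = 1 + k * x * cnj x" "k = of_real \<kappa>"
  defines "a \<equiv> \<omega>\<^sup>2 * E * (2 * s - k * x * cnj x) - k * x\<^sup>2 * E'"
    and "b \<equiv> E' * (2 * s - k * x * cnj x) - k * (cnj x)\<^sup>2 * E * \<omega>\<^sup>2"
    and "c \<equiv> \<omega> * (k * cnj x * E\<^sup>2 * \<omega>\<^sup>2 - k * x)"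
  shows "d_dir_integral \<kappa> (x, e) a b c = 0" "d_pos_integral \<kappa> (x, e) a b c = 0"
proof -
  have k: "of_real (\<kappa> / 2) = k / 2" by (simp add: assms)
  \<comment> \<open>Once the logarithmic derivative of the weight has this short form, both claims
    are polynomial identities modulo \<open>E * E' = 1\<close>.\<close>
  have l: "d_log_weight \<kappa> (x, e) a b c = k * (x - cnj x * e\<^sup>2) * E'"
    unfolding d_log_weight_def k fst_conv snd_conv a_def b_def c_def assms(2,3) using assms(1)
    by simp algebra
  have "c + e * (k * (x - cnj x * e\<^sup>2) * E') = 0"
    unfolding c_def assms(2) using assms(1) by algebra
  then show "d_dir_integral \<kappa> (x, e) a b c = 0"
    unfolding d_dir_integral_def l by simp
  have "a - e\<^sup>2 * b - 2 * cnj x * e * c + (x - cnj x * e\<^sup>2) * (k * (x - cnj x * e\<^sup>2) * E') = 0"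
    unfolding a_def b_def c_def assms(2,3) using assms(1) by algebra
  then show "d_pos_integral \<kappa> (x, e) a b c = 0"
    unfolding d_pos_integral_def l by simp
qed

section \<open>The bundles in the frame coordinate, and complexified tangent vectors\<close>

lemma SM_iff: "p \<in> SM R \<kappa> \<longleftrightarrow> norm (fst p) \<le> R \<and> norm (frame_coord \<kappa> (fst p) (snd p)) = 1"
  by (simp add: SM_def metric_eq_norm_frame_coord case_prod_unfold abs_square_eq_1)

lemma BM_iff: "p \<in> BM R \<kappa> \<longleftrightarrow> norm (fst p) \<le> R \<and> norm (frame_coord \<kappa> (fst p) (snd p)) \<le> 1"
  by (simp add: BM_def metric_eq_norm_frame_coord case_prod_unfold abs_square_le_1)

lemma capply_cscale: "linear l \<Longrightarrow> capply l (cscale c \<xi>) = c * capply l \<xi>"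
  by (simp add: capply_def cscale_def linear_add linear_diff linear_scale scaleR_conv_of_real complex_eq_iff algebra_simps)

lemma capply_add: "linear l \<Longrightarrow> capply l (\<xi> + \<eta>) = capply l \<xi> + capply l \<eta>"
  by (simp add: capply_def linear_add algebra_simps)

lemma capply_eta:
  assumes "linear l"
  defines "B \<equiv> \<lambda>\<kappa>. lie_bracket (geodesic_field \<kappa>) (circle_field \<kappa>)"
  shows "capply l (eta_plus \<kappa> p) = (l (geodesic_field \<kappa> p) + \<i> * l (B \<kappa> p)) / 2"
    and "capply l (eta_minus \<kappa> p) = (l (geodesic_field \<kappa> p) - \<i> * l (B \<kappa> p)) / 2"
  unfolding eta_plus_def eta_minus_def capply_cscale[OF assms(1)]
  by (simp_all add: capply_def B_def linear_neg[OF assms(1)])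

text \<open>Here \<open>D\<close> stands for any complex linear form in
  \<open>(dx, d(cnj x), de)\<close> that vanishes wherever the differentials of both first integrals
  do, and \<open>l\<close> is its pullback under \<open>(x, v) \<mapsto> (x, \<omega> * E)\<close>.
  The left side is \<open>l\<close> on
  \<open>2 * (\<eta>\<^sub>- + \<omega>\<^sup>2 * \<eta>\<^sub>+)\<close>, and \<open>s\<close>
  times that vector is the one treated in \<open>integrals_annihilated\<close>.\<close>

lemma eta_combination_eq_0:
  assumes "0 \<le> \<kappa>" and "norm (frame_coord \<kappa> (fst p) (snd p)) = 1"
    and lin: "\<And>t u a a' b b' c c'. D (t * a + u * a') (t * b + u * b') (t * c + u * c') = t * D a b c + u * D a' b' c'"
    and zero: "\<And>a b c. d_dir_integral \<kappa> (fst p, \<omega> * frame_coord \<kappa> (fst p) (snd p)) a b c = 0 \<Longrightarrow>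
      d_pos_integral \<kappa> (fst p, \<omega> * frame_coord \<kappa> (fst p) (snd p)) a b c = 0 \<Longrightarrow> D a b c = 0"
  defines "l \<equiv> \<lambda>h. D (fst h) (cnj (fst h)) (\<omega> * d_frame_coord \<kappa> p h)"
  shows "(l (geodesic_field \<kappa> p) - \<i> * l (lie_bracket (geodesic_field \<kappa>) (circle_field \<kappa>) p))
    + \<omega>\<^sup>2 * (l (geodesic_field \<kappa> p) + \<i> * l (lie_bracket (geodesic_field \<kappa>) (circle_field \<kappa>) p)) = 0"
proof -
  define x E s where "x = fst p" and "E = frame_coord \<kappa> (fst p) (snd p)"
    and "s = 1 + of_real \<kappa> * x * cnj x"
  define v r k where "v = snd p" and "r = rot \<kappa> x v" and "k = complex_of_real \<kappa>"
  define Q P where "Q = d_frame_coord \<kappa> p (geodesic_field \<kappa> p)"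
    and "P = d_frame_coord \<kappa> p (lie_bracket (geodesic_field \<kappa>) (circle_field \<kappa>) p)"
  have sr: "s = of_real (1 + \<kappa> * (x \<bullet> x))"
    by (simp add: s_def inner_complex_def complex_eq_iff algebra_simps)
  have s0: "s \<noteq> 0" unfolding sr of_real_eq_0_iff using conformal_factor_pos[OF assms(1), of x] by simp
  have sk: "s = 1 + k * x * cnj x" by (simp add: s_def k_def)
  have EE: "E * cnj E = 1"
    using assms(2) unfolding E_def by (simp add: complex_norm_square[symmetric])
  have "E = frame_coord \<kappa> x v" by (simp add: E_def x_def v_def)
  then have "v = frame_vec \<kappa> x E" "r = frame_vec \<kappa> x (\<i> * E)"
    using assms(1) by (simp_all add: r_def rot_eq_frame)
  \<comment> \<open>Clearing the denominator \<open>s\<close> and writing the inner product through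
    conjugates makes every component a polynomial in \<open>x\<close>, \<open>cnj x\<close>,
    \<open>y\<close> and \<open>cnj y\<close>.\<close>
  moreover have fv: "s * frame_vec \<kappa> x y = s * y - k * x * (cnj x * y + x * cnj y) / 2"
    "s * cnj (frame_vec \<kappa> x y) = s * cnj y - k * cnj x * (cnj x * y + x * cnj y) / 2" for y
  proof -
    have xy: "of_real (x \<bullet> y) = (cnj x * y + x * cnj y) / 2"
      by (simp add: inner_complex_def complex_eq_iff algebra_simps)
    have "s * frame_vec \<kappa> x y = s * y - k * of_real (x \<bullet> y) * x"
      unfolding frame_vec_def of_real_divide sr[symmetric] k_def using s0
      by (simp add: right_diff_distrib)
    then show 1: "s * frame_vec \<kappa> x y = s * y - k * x * (cnj x * y + x * cnj y) / 2"
      unfolding xy by simp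
    have "cnj s = s" "cnj k = k" unfolding sr k_def by simp_all
    then show "s * cnj (frame_vec \<kappa> x y) = s * cnj y - k * cnj x * (cnj x * y + x * cnj y) / 2"
      using arg_cong[OF 1, of cnj] by (simp add: add.commute)
  qed
  ultimately have v: "s * v = s * E - k * x * (cnj x * E + x * cnj E) / 2"
    "s * cnj v = s * cnj E - k * cnj x * (cnj x * E + x * cnj E) / 2"
    and r: "s * r = s * (\<i> * E) - k * x * (cnj x * (\<i> * E) + x * (- \<i> * cnj E)) / 2"
    "s * cnj r = s * (- \<i> * cnj E) - k * cnj x * (cnj x * (\<i> * E) + x * (- \<i> * cnj E)) / 2"
    using fv[of E] fv[of "\<i> * E"] by simp_all
  have im: "2 * \<i> * of_real (Im z) = z - cnj z" and re: "2 * of_real (Re z) = z + cnj z" for z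
    by (simp_all add: complex_eq_iff)
  have sQ: "s * Q = \<i> * k * E * of_real (Im (cnj x * E))"
    using geodesic_field_frame[OF assms(1), of "fst p" "snd p"] s0
    unfolding Q_def E_def k_def of_real_divide x_def[symmetric] sr[symmetric] by (simp add: x_def)
  have Q: "2 * s * Q = k * E * (cnj x * E - x * cnj E)"
  proof -
    have "2 * s * Q = k * E * (2 * \<i> * of_real (Im (cnj x * E)))"
      using sQ by (simp add: mult.assoc mult.left_commute)
    then show ?thesis unfolding im by simp
  qed
  have sP: "s * P = - \<i> * k * E * of_real (Re (cnj x * E))"
    using lie_bracket_frame(2)[OF assms(1), of p] s0
    unfolding P_def E_def k_def of_real_divide x_def[symmetric] sr[symmetric] by (simp add: x_def)
  have P: "2 * s * P = - \<i> * k * E * (cnj x * E + x * cnj E)"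
  proof -
    have "2 * s * P = - \<i> * k * E * (2 * of_real (Re (cnj x * E)))"
      using sP by (simp add: mult.assoc mult.left_commute)
    then show ?thesis unfolding re by simp
  qed
  \<comment> \<open>Coefficients of the geodesic field and of its bracket with the circle field in
    \<open>2 * (\<eta>\<^sub>- + \<omega>\<^sup>2 * \<eta>\<^sub>+)\<close>.\<close>
  define t u where "t = 1 + \<omega>\<^sup>2" and "u = \<i> * (\<omega>\<^sup>2 - 1)"
  \<comment> \<open>The vector \<open>- r\<close> is the base component of the bracket. The idle
    summand \<open>0 * 0\<close> gives the right side the two-term shape of \<open>lin\<close>, so
    that the factor \<open>1 / s\<close> can be pulled out of \<open>D\<close>.\<close>
  have a: "t * v + u * (- r) = 1 / s * (\<omega>\<^sup>2 * E * (2 * s - k * x * cnj x) - k * x\<^sup>2 * cnj E) + 0 * 0"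
  proof -
    have "s * (t * v + u * (- r)) = t * (s * v) - u * (s * r)" by (simp add: algebra_simps)
    also have "\<dots> = \<omega>\<^sup>2 * E * (2 * s - k * x * cnj x) - k * x\<^sup>2 * cnj E"
      unfolding v r t_def u_def by (simp add: field_simps power2_eq_square)
    finally show ?thesis using s0 by (simp add: field_simps)
  qed
  have b: "t * cnj v + u * cnj (- r)
      = 1 / s * (cnj E * (2 * s - k * x * cnj x) - k * (cnj x)\<^sup>2 * E * \<omega>\<^sup>2) + 0 * 0"
  proof -
    have "s * (t * cnj v + u * cnj (- r)) = t * (s * cnj v) - u * (s * cnj r)" by (simp add: algebra_simps)
    also have "\<dots> = cnj E * (2 * s - k * x * cnj x) - k * (cnj x)\<^sup>2 * E * \<omega>\<^sup>2"
      unfolding v r t_def u_def by (simp add: field_simps power2_eq_square)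
    finally show ?thesis using s0 by (simp add: field_simps)
  qed
  have c: "t * (\<omega> * Q) + u * (\<omega> * P) = 1 / s * (\<omega> * (k * cnj x * E\<^sup>2 * \<omega>\<^sup>2 - k * x)) + 0 * 0"
  proof -
    have "2 * s * (t * (\<omega> * Q) + u * (\<omega> * P)) = \<omega> * (t * (2 * s * Q) + u * (2 * s * P))"
      by (simp add: algebra_simps)
    also have "\<dots> = 2 * (\<omega> * (k * cnj x * E\<^sup>2 * \<omega>\<^sup>2 - k * x * (E * cnj E)))"
      unfolding Q P t_def u_def by (simp add: algebra_simps power2_eq_square)
    finally have "s * (t * (\<omega> * Q) + u * (\<omega> * P)) = \<omega> * (k * cnj x * E\<^sup>2 * \<omega>\<^sup>2 - k * x)"
      unfolding EE mult.assoc mult_cancel_left by simp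
    then show ?thesis using s0 by (simp add: field_simps)
  qed
  have "(l (geodesic_field \<kappa> p) - \<i> * l (lie_bracket (geodesic_field \<kappa>) (circle_field \<kappa>) p))
      + \<omega>\<^sup>2 * (l (geodesic_field \<kappa> p) + \<i> * l (lie_bracket (geodesic_field \<kappa>) (circle_field \<kappa>) p))
      = t * D v (cnj v) (\<omega> * Q) + u * D (- r) (cnj (- r)) (\<omega> * P)"
    unfolding l_def Q_def[symmetric] P_def[symmetric] lie_bracket_frame(1)[OF assms(1)]
    by (simp add: t_def u_def v_def r_def x_def geodesic_field_def case_prod_unfold algebra_simps)
  also have "\<dots> = 0"
    unfolding lin[symmetric] a b c unfolding lin
    using zero[folded x_def E_def, OF integrals_annihilated[OF EE refl sk k_def]] by simp
  finally show ?thesis .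
qed

lemma twistor_map_differentiable:
  assumes "0 \<le> \<kappa>"
  shows "twistor_map \<kappa> differentiable (at P)"
proof -
  have "(\<lambda>P. rot \<kappa> (fst (fst P)) (snd (fst P))) differentiable (at P)"
    using differentiable_chain_at[of fst P "\<lambda>p. rot \<kappa> (fst p) (snd p)"] rot_differentiable[OF assms]
    by (simp add: o_def bounded_linear_imp_differentiable[OF bounded_linear_fst])
  then obtain r' where r: "((\<lambda>P. rot \<kappa> (fst (fst P)) (snd (fst P))) has_derivative r') (at P)"
    unfolding differentiable_def by blast
  show ?thesis
    unfolding differentiable_def twistor_map_def act_def case_prod_unfold
    by (intro exI) (rule derivative_eq_intros r refl)+
qed

section \<open>Functions of the two first integrals and the equations they satisfy\<close>

definition integral_fun :: "real \<Rightarrow> nat \<Rightarrow> (complex \<Rightarrow> complex) \<Rightarrow> complex \<times> complex \<Rightarrow> complex" where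
  "integral_fun \<kappa> m B p = B (pos_integral \<kappa> p) * dir_integral \<kappa> p ^ m"

definition frame_chart :: "real \<Rightarrow> complex \<times> complex \<Rightarrow> complex \<times> complex" where
  "frame_chart \<kappa> p = (fst p, frame_coord \<kappa> (fst p) (snd p))"

text \<open>The chain rule writes \<open>D\<close> as a combination of the two differentials, so it
  inherits their complex linearity and common kernel. \<open>B\<close> need only be complex
  differentiable at the one value involved, which also covers values on the boundary circle.\<close>

lemma integral_fun_derivative:
  assumes "(B has_field_derivative b) (at (pos_integral \<kappa> p))"
  obtains D where
    "(integral_fun \<kappa> m B has_derivative (\<lambda>h. D (fst h) (cnj (fst h)) (snd h))) (at p)"
    "\<And>t u a a' b b' c c'. D (t * a + u * a') (t * b + u * b') (t * c + u * c') = t * D a b c + u * D a' b' c'"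
    "\<And>a b c. d_dir_integral \<kappa> p a b c = 0 \<Longrightarrow> d_pos_integral \<kappa> p a b c = 0 \<Longrightarrow> D a b c = 0"
proof
  define D where "D a b' c = b * d_pos_integral \<kappa> p a b' c * dir_integral \<kappa> p ^ m
      + B (pos_integral \<kappa> p) * (of_nat m * d_dir_integral \<kappa> p a b' c * dir_integral \<kappa> p ^ (m - 1))" for a b' c
  have "((\<lambda>p. B (pos_integral \<kappa> p)) has_derivative
      (\<lambda>h. b * d_pos_integral \<kappa> p (fst h) (cnj (fst h)) (snd h))) (at p)"
    using has_derivative_compose[OF has_derivative_pos_integral, of B "(*) b"] assms
    by (simp add: has_field_derivative_def)
  then show "(integral_fun \<kappa> m B has_derivative (\<lambda>h. D (fst h) (cnj (fst h)) (snd h))) (at p)"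
    unfolding integral_fun_def[abs_def] D_def
    by (rule has_derivative_eq_rhs[OF has_derivative_mult[OF _ has_derivative_power[OF has_derivative_dir_integral]]])
      (simp add: algebra_simps)
  show "D (t * a + u * a') (t * b + u * b') (t * c + u * c') = t * D a b c + u * D a' b' c'"
    for t u a a' b b' c c'
    unfolding D_def linear_d_dir_integral linear_d_pos_integral by (simp add: algebra_simps)
  show "D a b c = 0" if "d_dir_integral \<kappa> p a b c = 0" "d_pos_integral \<kappa> p a b c = 0" for a b c
    unfolding D_def using that by simp
qed

lemma has_derivative_frame_chart:
  "(frame_chart \<kappa> has_derivative (\<lambda>h. (fst h, d_frame_coord \<kappa> p h))) (at p)"
  unfolding frame_chart_def[abs_def]
  by (rule derivative_eq_intros refl)+ simp

text \<open>Evaluating on a pushed forward vector is differentiating the composite with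
  \<open>twistor_map\<close>. On the product with the disk the two generators of the distribution
  are then treated separately.\<close>

lemma twistor_derivative_eq_0:
  assumes \<kappa>: "0 \<le> \<kappa>" and p: "norm (frame_coord \<kappa> (fst p) (snd p)) = 1"
    and q: "twistor_map \<kappa> (p, \<omega>) = q"
    and B: "(B has_field_derivative b) (at (pos_integral \<kappa> (frame_chart \<kappa> q)))"
  defines "L \<equiv> frechet_derivative (twistor_map \<kappa>) (at (p, \<omega>))"
  shows "capply (frechet_derivative (\<lambda>p. integral_fun \<kappa> m B (frame_chart \<kappa> p)) (at q))
    (map_prod L L (cscale \<alpha> (twistor_eta \<kappa> (p, \<omega>)) + cscale \<beta> twistor_dbar)) = 0"
proof -
  define x E where "x = fst p" and "E = frame_coord \<kappa> (fst p) (snd p)"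
  define F where "F = (\<lambda>p. integral_fun \<kappa> m B (frame_chart \<kappa> p))"
  have q': "frame_chart \<kappa> q = (x, \<omega> * E)"
    unfolding q[symmetric] by (simp add: frame_chart_def twistor_map_def case_prod_unfold frame_coord_act \<kappa> x_def E_def)
  obtain D where D: "(integral_fun \<kappa> m B has_derivative (\<lambda>h. D (fst h) (cnj (fst h)) (snd h))) (at (x, \<omega> * E))"
    and lin: "\<And>t u a a' b b' c c'. D (t * a + u * a') (t * b + u * b') (t * c + u * c') = t * D a b c + u * D a' b' c'"
    and zero: "\<And>a b c. d_dir_integral \<kappa> (x, \<omega> * E) a b c = 0 \<Longrightarrow> d_pos_integral \<kappa> (x, \<omega> * E) a b c = 0 \<Longrightarrow> D a b c = 0"
    by (rule integral_fun_derivative[OF B, where m = m, unfolded q']) (rule that)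
  have "(F has_derivative (\<lambda>h. D (fst h) (cnj (fst h)) (d_frame_coord \<kappa> q h))) (at q)"
    unfolding F_def using has_derivative_compose[OF has_derivative_frame_chart D[folded q']] by simp
  then have F: "(F has_derivative frechet_derivative F (at q)) (at q)"
    unfolding frechet_derivative_works[symmetric] differentiable_def by blast
  have L: "(twistor_map \<kappa> has_derivative L) (at (p, \<omega>))"
    using twistor_map_differentiable[OF \<kappa>] unfolding L_def frechet_derivative_works .
  define l where "l h = frechet_derivative F (at q) (L h)" for h
  have l: "((\<lambda>P. F (twistor_map \<kappa> P)) has_derivative l) (at (p, \<omega>))"
    unfolding l_def using has_derivative_compose[OF L] F q by simp
  \<comment> \<open>In frame coordinates the action is multiplication by \<open>\<omega>\<close>,
    which gives a second, explicit derivative of the composite to compare with the one through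
    \<open>L\<close>.\<close>
  have F_map: "(\<lambda>P. F (twistor_map \<kappa> P))
      = (\<lambda>P. integral_fun \<kappa> m B (fst (fst P), snd P * frame_coord \<kappa> (fst (fst P)) (snd (fst P))))"
    by (simp add: F_def frame_chart_def twistor_map_def case_prod_unfold frame_coord_act \<kappa>)
  have "((\<lambda>P. (fst (fst P), snd P * frame_coord \<kappa> (fst (fst P)) (snd (fst P)))) has_derivative
      (\<lambda>h. (fst (fst h), \<omega> * d_frame_coord \<kappa> p (fst h) + snd h * E))) (at (p, \<omega>))"
    by (rule derivative_eq_intros refl)+ (simp add: E_def)
  from has_derivative_compose[OF this, of "integral_fun \<kappa> m B" "\<lambda>h. D (fst h) (cnj (fst h)) (snd h)"] D
  have "((\<lambda>P. F (twistor_map \<kappa> P)) has_derivative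
      (\<lambda>h. D (fst (fst h)) (cnj (fst (fst h))) (\<omega> * d_frame_coord \<kappa> p (fst h) + snd h * E))) (at (p, \<omega>))"
    unfolding F_map by (simp add: x_def E_def)
  then have l_eq: "l = (\<lambda>h. D (fst (fst h)) (cnj (fst (fst h))) (\<omega> * d_frame_coord \<kappa> p (fst h) + snd h * E))"
    by (rule has_derivative_unique[OF l])
  have linl: "linear l" using l by (rule has_derivative_linear)
  define l0 where "l0 = (\<lambda>h. l (h, 0))"
  have l0: "l0 = (\<lambda>h. D (fst h) (cnj (fst h)) (\<omega> * d_frame_coord \<kappa> p h))"
    by (simp add: l0_def l_eq)
  have "linear (\<lambda>h. l (h, 0))"
    by (rule linear_compose[OF _ linl, unfolded o_def]) (auto intro!: linearI)
  then have linl0: "linear l0" unfolding l0_def .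
  have comb: "(l0 (geodesic_field \<kappa> p) - \<i> * l0 (lie_bracket (geodesic_field \<kappa>) (circle_field \<kappa>) p))
    + \<omega>\<^sup>2 * (l0 (geodesic_field \<kappa> p) + \<i> * l0 (lie_bracket (geodesic_field \<kappa>) (circle_field \<kappa>) p)) = 0"
    unfolding l0
    by (rule eta_combination_eq_0[where D = D, OF \<kappa> p lin zero[unfolded x_def E_def]])
  have "capply l (map_prod (\<lambda>\<xi>. (\<xi>, 0)) (\<lambda>\<xi>. (\<xi>, 0)) \<xi>) = capply l0 \<xi>" for \<xi>
    by (simp add: capply_def l0_def)
  then have "capply l (twistor_eta \<kappa> (p, \<omega>)) = 0"
    unfolding twistor_eta_def using comb
    by (simp add: capply_add capply_cscale capply_eta linl0 flip: add_divide_distrib)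
  \<comment> \<open>The composite depends on \<open>\<omega>\<close> through
    \<open>\<omega> * E\<close> only, and \<open>D\<close> is complex linear in its last
    argument.\<close>
  moreover have "capply l twistor_dbar = 0"
  proof -
    have "D 0 0 (\<i> * E) = \<i> * D 0 0 E" using lin[of \<i> 0 0 0 0 0 E 0] by simp
    then show ?thesis
      unfolding twistor_dbar_def capply_cscale[OF linl]
      by (simp add: capply_def l_eq d_frame_coord_def frame_coord_def zero_prod_def)
  qed
  ultimately have "capply l (cscale \<alpha> (twistor_eta \<kappa> (p, \<omega>)) + cscale \<beta> twistor_dbar) = 0"
    by (simp add: capply_add capply_cscale linl)
  then show ?thesis by (simp add: capply_def l_def F_def)
qed

text \<open>The case \<open>\<omega> = 1\<close> of \<open>eta_combination_eq_0\<close>, where the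
  bracket terms cancel and twice the geodesic field remains.\<close>

lemma geodesic_derivative_eq_0:
  assumes \<kappa>: "0 \<le> \<kappa>" and p: "norm (frame_coord \<kappa> (fst p) (snd p)) = 1"
    and B: "(B has_field_derivative b) (at (pos_integral \<kappa> (frame_chart \<kappa> p)))"
  shows "frechet_derivative (\<lambda>p. integral_fun \<kappa> m B (frame_chart \<kappa> p)) (at p) (geodesic_field \<kappa> p) = 0"
proof -
  define x E where "x = fst p" and "E = frame_coord \<kappa> (fst p) (snd p)"
  have p': "frame_chart \<kappa> p = (x, E)" by (simp add: frame_chart_def x_def E_def)
  obtain D where D: "(integral_fun \<kappa> m B has_derivative (\<lambda>h. D (fst h) (cnj (fst h)) (snd h))) (at (x, E))"
    and lin: "\<And>t u a a' b b' c c'. D (t * a + u * a') (t * b + u * b') (t * c + u * c') = t * D a b c + u * D a' b' c'"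
    and zero: "\<And>a b c. d_dir_integral \<kappa> (x, E) a b c = 0 \<Longrightarrow> d_pos_integral \<kappa> (x, E) a b c = 0 \<Longrightarrow> D a b c = 0"
    by (rule integral_fun_derivative[OF B, where m = m, unfolded p']) (rule that)
  have "((\<lambda>p. integral_fun \<kappa> m B (frame_chart \<kappa> p)) has_derivative
      (\<lambda>h. D (fst h) (cnj (fst h)) (d_frame_coord \<kappa> p h))) (at p)"
    using has_derivative_compose[OF has_derivative_frame_chart D[folded p']] by simp
  note F = frechet_derivative_at[OF this, symmetric]
  have "2 * D (fst (geodesic_field \<kappa> p)) (cnj (fst (geodesic_field \<kappa> p))) (1 * d_frame_coord \<kappa> p (geodesic_field \<kappa> p)) = 0"
    using eta_combination_eq_0[where D = D and \<omega> = 1, OF \<kappa> p lin] zero by (simp add: x_def E_def)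
  then show ?thesis unfolding F by simp
qed

section \<open>Uniqueness of Fourier modes\<close>

lemma sum_roots_of_unity_eq_0:
  fixes n :: int and N :: nat
  assumes "n \<noteq> 0" "\<bar>n\<bar> < int N"
  shows "(\<Sum>j<N. cis (of_int n * (2 * pi * real j / real N))) = 0"
proof -
  define w where "w = cis (of_int n * (2 * pi / real N))"
  have N: "real N > 0" using assms by auto
  have "w \<noteq> 1"
  proof
    assume "w = 1"
    then obtain i :: int where "of_int n * (2 * pi / real N) = of_int (2 * i) * pi"
      unfolding w_def cis_conv_exp exp_eq_1 by auto
    then have "of_int n = (of_int i * real N)" using N by (simp add: field_simps)
    then have n: "n = i * int N" by (metis of_int_eq_iff of_int_mult of_int_of_nat_eq)
    then have "int N dvd n" by simp
    then show False using assms zdvd_not_zless[of "\<bar>n\<bar>" "int N"] by simp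
  qed
  moreover have "w ^ N = cis (2 * pi * of_int n)"
    unfolding w_def Complex.DeMoivre using N by (intro arg_cong[where f = cis]) simp
  then have "w ^ N = 1" by simp
  moreover have "cis (of_int n * (2 * pi * real j / real N)) = w ^ j" for j
    unfolding w_def Complex.DeMoivre by (intro arg_cong[where f = cis]) simp
  ultimately show ?thesis by (simp add: sum_gp_strict)
qed

text \<open>
  Averaging over the \<open>N\<close>-th roots of unity leaves the coefficients congruent to \<open>k\<close> modulo \<open>N\<close>,
  and the tail of these vanishes as \<open>N\<close> grows.
\<close>

lemma fourier_coefficients_unique:
  fixes a :: "int \<Rightarrow> complex"
  assumes "\<And>t. ((\<lambda>k. a k * cis (of_int k * t)) has_sum 0) UNIV"
  shows "a k = 0"
proof -
  have "a summable_on UNIV" using assms[of 0] by (auto simp: summable_on_def)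
  then obtain S where S: "((\<lambda>k. norm (a k)) has_sum S) UNIV"
    by (auto simp: summable_on_iff_abs_summable_on_complex summable_on_def)
  have "norm (a k) \<le> 0 + \<epsilon>" if "\<epsilon> > 0" for \<epsilon>
  proof -
    obtain F0 where F0: "finite F0" "dist (sum (\<lambda>k. norm (a k)) F0) S \<le> \<epsilon>"
      using has_sum_finite_approximation[OF S \<open>\<epsilon> > 0\<close>] by auto
    define F where "F = insert k F0"
    have F: "finite F" "k \<in> F" "F0 \<subseteq> F" using F0 by (auto simp: F_def)
    have SF: "S - (\<Sum>k\<in>F. norm (a k)) \<le> \<epsilon>"
      using sum_mono2[OF F(1,3), of "\<lambda>k. norm (a k)"] F0(2) by (auto simp: dist_real_def)
    \<comment> \<open>Larger than every distance from \<open>k\<close> within \<open>F\<close>, so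
      that no other index in \<open>F\<close> is congruent to \<open>k\<close> modulo
      \<open>N\<close>.\<close>
    define N where "N = nat (Max ((\<lambda>l. \<bar>l - k\<bar>) ` F)) + 1"
    have N: "\<bar>l - k\<bar> < int N" if "l \<in> F" for l
    proof -
      have "\<bar>l - k\<bar> \<le> Max ((\<lambda>l. \<bar>l - k\<bar>) ` F)" using F(1) that by (intro Max_ge) auto
      then show ?thesis unfolding N_def by linarith
    qed
    define t where "t j = 2 * pi * real j / real N" for j
    \<comment> \<open>The averaging kernel: 1 at 0, 0 at the other differences \<open>l - k\<close>
      with \<open>l\<close> in \<open>F\<close>, and at most 1 in norm everywhere.\<close>
    define K where "K n = (\<Sum>j<N. cis (of_int n * t j)) / of_nat N" for n :: int
    have N0: "N > 0" by (simp add: N_def)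
    have K0: "K 0 = 1" using N0 by (simp add: K_def)
    have K1: "K (l - k) = 0" if "l \<in> F" "l \<noteq> k" for l
      using sum_roots_of_unity_eq_0[of "l - k" N] N that by (simp add: K_def t_def)
    have K2: "norm (K n) \<le> 1" for n
    proof -
      have "norm (\<Sum>j<N. cis (of_int n * t j)) \<le> (\<Sum>j<N. 1)" by (rule sum_norm_le) simp
      then show ?thesis using N0 by (simp add: K_def norm_divide divide_le_eq)
    qed
    have "((\<lambda>l. \<Sum>j\<in>J. cis (- of_int k * t j) * (a l * cis (of_int l * t j))) has_sum 0) UNIV" for J :: "nat set"
    proof (induction J rule: infinite_finite_induct)
      case (insert j J)
      then show ?case
        using has_sum_add[OF has_sum_cmult_right[OF assms[of "t j"], of "cis (- of_int k * t j)"] insert.IH] by simp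
    qed auto
    from has_sum_cmult_right[OF this[of "{..<N}"], of "1 / of_nat N"]
    have "((\<lambda>l. a l * K (l - k)) has_sum 0) UNIV"
      by (simp add: K_def sum_divide_distrib sum_distrib_left cis_mult algebra_simps)
    \<comment> \<open>Removing the term at \<open>k\<close> leaves a series supported outside
      \<open>F\<close> with sum \<open>- a k\<close>. It is dominated by the tail of the norms,
      whose sum is at most \<open>\<epsilon>\<close>.\<close>
    moreover have "((\<lambda>l. if l = k then - a k else 0) has_sum - a k) UNIV"
      by (rule has_sum_finite_neutralI[of "{k}"]) auto
    ultimately have "((\<lambda>l. a l * K (l - k) + (if l = k then - a k else 0)) has_sum 0 + - a k) UNIV"
      by (rule has_sum_add)
    moreover have "((\<lambda>l. norm (a l) + (if l \<in> F then - norm (a l) else 0)) has_sum S + - (\<Sum>l\<in>F. norm (a l))) UNIV"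
      by (intro has_sum_add S has_sum_finite_neutralI[of F]) (auto simp: F sum_negf)
    ultimately have "norm (0 + - a k) \<le> S + - (\<Sum>l\<in>F. norm (a l))"
    proof (rule norm_infsum_le)
      fix l
      have "norm (a l) * norm (K (l - k)) \<le> norm (a l)"
        using K2[of "l - k"] by (simp add: mult_left_le)
      then show "norm (a l * K (l - k) + (if l = k then - a k else 0))
          \<le> norm (a l) + (if l \<in> F then - norm (a l) else 0)"
        using K1[of l] K0 F(2) by (cases "l = k"; cases "l \<in> F") (auto simp: norm_mult)
    qed
    then show ?thesis using SF by simp
  qed
  then have "norm (a k) \<le> 0" by (rule field_le_epsilon)
  then show ?thesis by simp
qed

section \<open>Fourier modes along the fibre circles\<close>

lemma SM_point:
  assumes "0 \<le> \<kappa>" "p \<in> SM R \<kappa>"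
  obtains t where "p = (fst p, frame_vec \<kappa> (fst p) (cis t))"
proof -
  have "norm (frame_coord \<kappa> (fst p) (snd p)) = 1" using assms by (simp add: SM_iff)
  then have "frame_coord \<kappa> (fst p) (snd p) = cis (Arg (frame_coord \<kappa> (fst p) (snd p)))"
    by (metis rcis_cmod_Arg rcis_def mult_1 of_real_1)
  then show ?thesis using that frame_vec_coord[OF assms(1)] by (metis prod.collapse)
qed

text \<open>The curve \<open>t \<mapsto> (x, frame_vec \<kappa> x (cis t))\<close> is an integral
  curve of the circle field inside \<open>SM\<close>, so \<open>cis (- k * t)\<close> times the
  function has zero derivative along it.\<close>

lemma Omega_rotate:
  assumes \<kappa>: "0 \<le> \<kappa>" and g: "g \<in> Omega R \<kappa> k" and x: "norm x \<le> R"
  shows "g (x, frame_vec \<kappa> x (cis t)) = cis (of_int k * t) * g (x, frame_vec \<kappa> x 1)"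
proof -
  obtain U F where F: "smooth_extension (SM R \<kappa>) g U F"
    and dF: "\<And>p. p \<in> SM R \<kappa> \<Longrightarrow> frechet_derivative F (at p) (circle_field \<kappa> p) = \<i> * of_int k * g p"
    using g unfolding Omega_def has_lie_derivative_on_def by blast
  have fg: "F p = g p" if "p \<in> SM R \<kappa>" for p
    using F that unfolding smooth_extension_def by blast
  define c where "c t = (x, frame_vec \<kappa> x (cis t))" for t
  have cS: "c t \<in> SM R \<kappa>" for t by (simp add: c_def SM_iff \<kappa> x)
  have dc: "(c has_derivative (\<lambda>h. h *\<^sub>R circle_field \<kappa> (c t))) (at t)" for t
  proof -
    have "(c has_derivative (\<lambda>h. (0, frame_vec \<kappa> x (h *\<^sub>R (\<i> * cis t))))) (at t)"
      unfolding c_def[abs_def]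
      by (intro has_derivative_Pair has_derivative_const bounded_linear.has_derivative[OF bounded_linear_frame_vec]
          has_derivative_cis has_derivative_ident)
    then show ?thesis
      using \<kappa> by (simp add: c_def circle_field_def rot_eq_frame linear_scale[OF bounded_linear.linear[OF bounded_linear_frame_vec]])
  qed
  define \<phi> where "\<phi> t = cis (- of_int k * t) * F (c t)" for t
  have "(\<phi> has_derivative (\<lambda>h. 0)) (at t)" for t
  proof -
    note dFc = smooth_extension_differentiable[OF F cS[of t]]
    have "((\<lambda>t. F (c t)) has_derivative (\<lambda>h. h *\<^sub>R (\<i> * of_int k * F (c t)))) (at t)"
      using has_derivative_compose[OF dc dFc] linear_scale[OF has_derivative_linear[OF dFc]]
      by (simp add: dF cS fg)
    moreover have "((\<lambda>t. cis (- of_int k * t)) has_derivative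
        (\<lambda>h. (- of_int k * h) *\<^sub>R (\<i> * cis (- of_int k * t)))) (at t)"
      by (intro has_derivative_cis has_derivative_mult_right has_derivative_ident)
    ultimately have "((\<lambda>t. cis (- of_int k * t) * F (c t)) has_derivative (\<lambda>h. cis (- of_int k * t) * (h *\<^sub>R (\<i> * of_int k * F (c t)))
        + (- of_int k * h) *\<^sub>R (\<i> * cis (- of_int k * t)) * F (c t))) (at t)"
      by (intro has_derivative_mult)
    then show ?thesis
      unfolding \<phi>_def[abs_def] by (simp add: scaleR_conv_of_real algebra_simps)
  qed
  then have "\<phi> t = \<phi> 0" by (intro has_derivative_zero_unique[of UNIV]) auto
  then have "cis (of_int k * t) * \<phi> t = cis (of_int k * t) * \<phi> 0" by simp
  then have "F (c t) = cis (of_int k * t) * F (c 0)"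
    by (simp add: \<phi>_def cis_mult flip: mult.assoc)
  then show ?thesis unfolding fg[OF cS] by (simp add: c_def)
qed

text \<open>On one fibre circle two decompositions become trigonometric series with the same sum, so
  their coefficients agree. Hence the definite description in \<open>fourier_mode\<close>
  denotes.\<close>

lemma fourier_mode_eq:
  assumes \<kappa>: "0 \<le> \<kappa>" and c: "fourier_decomposition R \<kappa> UNIV u c" and p: "p \<in> SM R \<kappa>"
  shows "fourier_mode R \<kappa> k u p = c k p"
proof -
  have "c' k p = c k p" if c': "fourier_decomposition R \<kappa> UNIV u c'" for c'
  proof -
    define x where "x = fst p"
    have x: "norm x \<le> R" using p by (simp add: x_def SM_iff)
    define a where "a k = c' k (x, frame_vec \<kappa> x 1) - c k (x, frame_vec \<kappa> x 1)" for k
    have rot: "c' k (x, frame_vec \<kappa> x (cis t)) - c k (x, frame_vec \<kappa> x (cis t)) = a k * cis (of_int k * t)" for k t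
    proof -
      have "c' k \<in> Omega R \<kappa> k" "c k \<in> Omega R \<kappa> k"
        using c c' by (simp_all add: fourier_decomposition_def)
      note this[THEN Omega_rotate[OF \<kappa> _ x]]
      then show ?thesis by (simp add: a_def algebra_simps)
    qed
    have "((\<lambda>k. a k * cis (of_int k * t)) has_sum 0) UNIV" for t
    proof -
      have "(x, frame_vec \<kappa> x (cis t)) \<in> SM R \<kappa>" by (simp add: SM_iff \<kappa> x)
      then have "((\<lambda>k. c' k (x, frame_vec \<kappa> x (cis t)) + - c k (x, frame_vec \<kappa> x (cis t)))
          has_sum u (x, frame_vec \<kappa> x (cis t)) + - u (x, frame_vec \<kappa> x (cis t))) UNIV"
        using c c' unfolding fourier_decomposition_def by (intro has_sum_add) (auto simp: has_sum_uminus)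
      then show ?thesis using rot[of _ t] by simp
    qed
    then have "a k = 0" by (rule fourier_coefficients_unique)
    moreover obtain t where "p = (x, frame_vec \<kappa> x (cis t))"
      using SM_point[OF \<kappa> p] unfolding x_def by blast
    ultimately show ?thesis using rot[of k t] by simp
  qed
  then show ?thesis
    unfolding fourier_mode_def using c by (intro the_equality) blast+
qed

section \<open>Fibrewise Taylor expansion\<close>

lemma Ck_on_fst: "Ck_on k U fst" and Ck_on_snd: "Ck_on k U snd"
  by (intro Ck_on_bounded_linear bounded_linear_fst bounded_linear_snd)+

lemma Ck_on_cnj_fst: "Ck_on k U (\<lambda>p. cnj (fst p))"
  by (intro Ck_on_bounded_linear bounded_linear_compose[OF bounded_linear_cnj] bounded_linear_fst)

lemma Ck_on_weight: "Ck_on k UNIV (weight \<kappa>)"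
  unfolding weight_def[abs_def]
  by (rule Ck_on_compose[OF open_UNIV open_UNIV subset_UNIV Ck_on_exp])
    (intro Ck_on_mult Ck_on_diff Ck_on_power Ck_on_const Ck_on_fst Ck_on_snd Ck_on_cnj_fst open_UNIV)

lemma Ck_on_dir_integral: "Ck_on k UNIV (dir_integral \<kappa>)"
  unfolding dir_integral_def[abs_def] by (intro Ck_on_mult Ck_on_snd Ck_on_weight open_UNIV)

lemma Ck_on_pos_integral: "Ck_on k UNIV (pos_integral \<kappa>)"
  unfolding pos_integral_def[abs_def]
  by (intro Ck_on_mult Ck_on_diff Ck_on_power Ck_on_fst Ck_on_snd Ck_on_cnj_fst Ck_on_weight open_UNIV)

lemma Ck_on_frame_coord: "Ck_on k UNIV (\<lambda>p. frame_coord \<kappa> (fst p) (snd p))"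
  unfolding frame_coord_def scaleR_conv_of_real[symmetric]
  by (intro Ck_on_add Ck_on_scaleR Ck_on_mult Ck_on_const Ck_on_inner Ck_on_fst Ck_on_snd open_UNIV)

lemma Ck_on_frame_chart: "Ck_on k UNIV (frame_chart \<kappa>)"
  unfolding frame_chart_def[abs_def] by (intro Ck_on_Pair Ck_on_fst Ck_on_frame_coord open_UNIV)

text \<open>A second derivative that stays bounded up to the circle gives Taylor coefficients of
  order \<open>1 / n\<^sup>2\<close> by Cauchy's inequality. The series then converges absolutely on
  the closed disk, and the identity passes from the open disk to its closure by continuity.\<close>

lemma power_series_has_sum_closed_disk:
  assumes h: "h holomorphic_on ball 0 1" "continuous_on (cball 0 1) h"
    and g: "continuous_on (cball 0 1) g" "\<And>e. e \<in> ball 0 1 \<Longrightarrow> (deriv ^^ 2) h e = g e"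
    and e: "e \<in> cball 0 1"
  shows "((\<lambda>n. (deriv ^^ n) h 0 / fact n * e ^ n) has_sum h e) UNIV"
proof -
  define a where "a n = (deriv ^^ n) h 0 / fact n" for n
  have h2: "(deriv ^^ 2) h holomorphic_on ball 0 1"
    by (rule holomorphic_higher_deriv[OF h(1) open_ball])
  then have holg: "g holomorphic_on ball 0 1"
    by (rule holomorphic_transform) (simp add: g(2))
  have "bounded (g ` cball 0 1)"
    by (intro compact_imp_bounded compact_continuous_image g(1) compact_cball)
  then obtain M where M: "\<And>z. z \<in> cball 0 1 \<Longrightarrow> norm (g z) \<le> M"
    unfolding bounded_iff by blast
  have a_le: "norm (a (n + 2)) \<le> M * inverse (real (Suc n) ^ 2)" for n
  proof -
    have "(deriv ^^ (n + 2)) h 0 = (deriv ^^ n) ((deriv ^^ 2) h) 0" by (simp only: funpow_add o_apply)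
    also have "\<dots> = (deriv ^^ n) g 0"
      by (rule higher_deriv_transform_within_open[OF h2 holg open_ball]) (simp_all add: g(2))
    finally have "norm ((deriv ^^ (n + 2)) h 0) \<le> fact n * M / 1 ^ n"
      using Cauchy_inequality[OF holg g(1), of M n] M by simp
    then have "norm (a (n + 2)) \<le> fact n * M / fact (n + 2)"
      by (simp add: a_def norm_divide divide_right_mono del: fact_Suc)
    also have "\<dots> = M * (1 / (real (n + 2) * real (n + 1)))"
      by simp
    also have "\<dots> \<le> M * inverse (real (Suc n) ^ 2)"
    proof (rule mult_left_mono)
      show "1 / (real (n + 2) * real (n + 1)) \<le> inverse (real (Suc n) ^ 2)"
        by (simp add: power2_eq_square inverse_eq_divide frac_le)
      show "0 \<le> M" using order_trans[OF norm_ge_zero M[of 0]] by simp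
    qed
    finally show ?thesis .
  qed
  have "summable (\<lambda>n. M * inverse (real (Suc n) ^ 2))"
    using inverse_power_summable[of 2, where 'a = real] by (intro summable_mult) (subst summable_Suc_iff, simp)
  then have "summable (\<lambda>n. norm (a (n + 2)))"
    by (rule summable_comparison_test'[where N = 0]) (use a_le in simp)
  then have sa: "summable (\<lambda>n. norm (a n))"
    by (simp only: summable_iff_shift[of "\<lambda>n. norm (a n)" 2])
  have bound: "norm (a n * z ^ n) \<le> norm (a n)" if "z \<in> cball 0 1" for n z
    using that by (simp add: norm_mult norm_power mult_left_le power_le_one)
  have "uniform_limit (cball 0 1) (\<lambda>N z. \<Sum>n<N. a n * z ^ n) (\<lambda>z. \<Sum>n. a n * z ^ n) sequentially"
    by (rule Weierstrass_m_test[OF bound sa])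
  then have "continuous_on (cball 0 1) (\<lambda>z. \<Sum>n. a n * z ^ n)"
    by (rule uniform_limit_theorem[rotated]) (auto intro!: always_eventually continuous_intros)
  then have cont: "continuous_on (closure (ball 0 1)) (\<lambda>z. (\<Sum>n. a n * z ^ n) - h z)"
    by (simp add: continuous_on_diff h(2))
  have "(\<Sum>n. a n * z ^ n) - h z = 0" if "z \<in> ball 0 1" for z
    using holomorphic_power_series[OF h(1) that] by (simp add: a_def sums_iff)
  from continuous_constant_on_closure[OF cont this, of e] have "(\<Sum>n. a n * e ^ n) = h e"
    using e by simp
  moreover have sn: "summable (\<lambda>n. norm (a n * e ^ n))"
    using bound[OF e] by (intro summable_comparison_test'[OF sa]) auto
  ultimately have "(\<lambda>n. a n * e ^ n) sums h e"
    using summable_norm_cancel[OF sn] by (simp add: sums_iff)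
  then show ?thesis
    using norm_summable_imp_has_sum[OF sn] by (simp add: a_def)
qed

text \<open>A real directional derivative, hence meaningful for every smooth \<open>G\<close>; it is
  the complex fibre derivative where \<open>G\<close> is holomorphic in the second variable.\<close>

definition fibre_derivative :: "(complex \<times> complex \<Rightarrow> complex) \<Rightarrow> complex \<times> complex \<Rightarrow> complex" where
  "fibre_derivative G p = frechet_derivative G (at p) (0, 1)"

text \<open>Taking the coefficients as iterated directional derivatives on the zero section makes
  them smooth in \<open>x\<close> near the boundary as well, without any holomorphy. Holomorphy in
  the fibre enters only in the expansion.\<close>

lemma fibre_taylor:
  assumes W: "open W" and H: "\<And>k. Ck_on k W H"
  shows Ck_fibre_taylor: "Ck_on k {x. (x, 0) \<in> W} (\<lambda>x. (fibre_derivative ^^ n) H (x, 0) / fact n)"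
    and has_sum_fibre_taylor: "\<lbrakk>{x} \<times> cball 0 1 \<subseteq> W; (\<lambda>e. H (x, e)) holomorphic_on ball 0 1; e \<in> cball 0 1\<rbrakk>
      \<Longrightarrow> ((\<lambda>n. (fibre_derivative ^^ n) H (x, 0) / fact n * e ^ n) has_sum H (x, e)) UNIV"
proof -
  have D: "Ck_on k W ((fibre_derivative ^^ n) H)" for k n
  proof (induction n arbitrary: k)
    case (Suc n)
    then show ?case
      using Ck_on_Suc_deriv[OF Suc[of "Suc k"], of "(0, 1)"] by (simp add: fibre_derivative_def[abs_def] del: Ck_on.simps)
  qed (simp add: H)
  have c: "continuous_on A (\<lambda>x. (x, 0::complex))" for A :: "complex set" by (intro continuous_intros)
  have V: "open {x. (x, 0) \<in> W}"
    using open_vimage[OF W, of "\<lambda>x. (x, 0)"] c by (simp add: vimage_def)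
  have "Ck_on k {x. (x, 0) \<in> W} (\<lambda>x. (fibre_derivative ^^ n) H (x, 0))"
    by (rule Ck_on_compose[OF W V _ D])
      (auto intro!: Ck_on_bounded_linear bounded_linear_Pair bounded_linear_ident bounded_linear_zero)
  from Ck_on_mult[OF V this Ck_on_const[of k _ "1 / fact n"]]
  show "Ck_on k {x. (x, 0) \<in> W} (\<lambda>x. (fibre_derivative ^^ n) H (x, 0) / fact n)" by simp
  assume x: "{x} \<times> cball 0 1 \<subseteq> W" and hol: "(\<lambda>e. H (x, e)) holomorphic_on ball 0 1" and e: "e \<in> cball 0 1"
  define h where "h n e = (fibre_derivative ^^ n) H (x, e)" for n e
  have cont: "continuous_on (cball 0 1) (h n)" for n
    unfolding h_def[abs_def]
    by (rule continuous_on_compose2[OF Ck_on_imp_continuous_on[OF D[of 0 n]]])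
      (use x in \<open>auto intro!: continuous_intros\<close>)
  have dn: "(deriv ^^ n) (h 0) e = h n e" if "e \<in> ball 0 1" for n e
    using that
  proof (induction n arbitrary: e)
    case (Suc n)
    have "(deriv ^^ n) (h 0) holomorphic_on ball 0 1"
      by (rule holomorphic_higher_deriv[OF _ open_ball]) (simp add: h_def[abs_def] hol)
    then have "h n holomorphic_on ball 0 1" by (rule holomorphic_transform) (simp add: Suc.IH)
    then have 1: "(h n has_field_derivative deriv (h n) e) (at e)"
      using Suc.prems by (intro holomorphic_derivI[OF _ open_ball])
    have "(x, e) \<in> W" using x Suc.prems by auto
    then have "((fibre_derivative ^^ n) H has_derivative frechet_derivative ((fibre_derivative ^^ n) H) (at (x, e))) (at (x, e))"
      by (rule Ck_on_Suc_has_derivative[OF D[of "Suc 0" n]])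
    from has_derivative_compose[OF has_derivative_Pair[OF has_derivative_const has_derivative_ident] this]
    have "(h n has_derivative (\<lambda>d. frechet_derivative ((fibre_derivative ^^ n) H) (at (x, e)) (0, d))) (at e)"
      by (simp add: h_def[abs_def])
    from has_derivative_unique[OF this 1[unfolded has_field_derivative_def], THEN fun_cong, of 1]
    have "h (Suc n) e = deriv (h n) e" by (simp add: h_def fibre_derivative_def)
    also have "\<dots> = deriv ((deriv ^^ n) (h 0)) e"
      by (rule deriv_cong_ev)
        (use Suc.prems Suc.IH in \<open>auto simp: eventually_nhds intro!: exI[of _ "ball 0 1"]\<close>)
    finally show ?case by simp
  qed simp
  \<comment> \<open>\<open>h 2\<close> is the continuous extension of the second complex derivative
    to the closed disk.\<close>
  have "((\<lambda>n. (deriv ^^ n) (h 0) 0 / fact n * e ^ n) has_sum h 0 e) UNIV"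
    by (rule power_series_has_sum_closed_disk[OF _ cont cont[of 2] dn e]) (use hol in \<open>simp_all add: h_def[abs_def]\<close>)
  then show "((\<lambda>n. (fibre_derivative ^^ n) H (x, 0) / fact n * e ^ n) has_sum H (x, e)) UNIV"
    by (simp add: dn) (simp add: h_def)
qed

section \<open>The range of the first integrals\<close>

lemma norm_pos_integral_le:
  assumes "0 \<le> \<kappa>"
  shows "norm (pos_integral \<kappa> p) \<le> norm (fst p) * (1 + (norm (snd p))\<^sup>2)
    * exp (\<kappa> * (norm (fst p))\<^sup>2 * (1 + (norm (snd p))\<^sup>2) / 2)"
proof -
  define x e where "x = fst p" and "e = snd p"
  have "norm (x - cnj x * e\<^sup>2) \<le> norm x * (1 + (norm e)\<^sup>2)"
    using norm_triangle_ineq4[of x "cnj x * e\<^sup>2"] by (simp add: norm_mult norm_power algebra_simps)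
  moreover have "norm (weight \<kappa> p) \<le> exp (\<kappa> * (norm x)\<^sup>2 * (1 + (norm e)\<^sup>2) / 2)"
  proof -
    define z where "z = of_real (\<kappa> / 2) * (x * cnj x - (cnj x)\<^sup>2 * e\<^sup>2)"
    have "Re z \<le> norm z" by (rule complex_Re_le_cmod)
    also have "norm z \<le> \<kappa> / 2 * (norm (x * cnj x) + norm ((cnj x)\<^sup>2 * e\<^sup>2))"
      unfolding z_def norm_mult[of "of_real _"] using assms by (intro mult_mono norm_triangle_ineq4) auto
    also have "\<dots> = \<kappa> * (norm x)\<^sup>2 * (1 + (norm e)\<^sup>2) / 2"
      by (simp add: norm_mult norm_power power2_eq_square algebra_simps)
    finally show ?thesis by (simp add: weight_def z_def x_def e_def)
  qed
  ultimately show ?thesis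
    unfolding pos_integral_def norm_mult x_def e_def by (intro mult_mono) auto
qed

text \<open>This is where the radius \<open>2 * R * exp (\<kappa> * R\<^sup>2)\<close> comes from:
  \<open>1 + (norm (snd p))\<^sup>2\<close> is at most 2, both as a factor and in the
  exponent.\<close>

lemma pos_integral_in_cball:
  assumes "0 \<le> \<kappa>" "norm (fst p) \<le> R" "norm (snd p) \<le> 1"
  shows "pos_integral \<kappa> p \<in> cball 0 (2 * R * exp (\<kappa> * R\<^sup>2))"
proof -
  have "(norm (snd p))\<^sup>2 \<le> 1" using assms(3) by (simp add: abs_square_le_1)
  moreover have "(norm (fst p))\<^sup>2 \<le> R\<^sup>2" using assms(2) by (simp add: power_mono)
  moreover have "0 \<le> R" using assms(2) norm_ge_zero order_trans by blast
  ultimately have "norm (fst p) * (1 + (norm (snd p))\<^sup>2) * exp (\<kappa> * (norm (fst p))\<^sup>2 * (1 + (norm (snd p))\<^sup>2) / 2)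
      \<le> R * 2 * exp (\<kappa> * R\<^sup>2 * 2 / 2)"
    using assms by (intro mult_mono iffD2[OF exp_le_cancel_iff] divide_right_mono) auto
  then show ?thesis using norm_pos_integral_le[OF assms(1), of p] by (simp add: mult.commute)
qed

text \<open>The strict version puts the interior of each fibre disk, also over boundary points of
  the base, into the open disk on which holomorphy is assumed.\<close>

lemma pos_integral_in_ball:
  assumes "0 < R" "0 \<le> \<kappa>" "norm (fst p) \<le> R" "norm (snd p) < 1"
  shows "pos_integral \<kappa> p \<in> ball 0 (2 * R * exp (\<kappa> * R\<^sup>2))"
proof -
  have e: "(norm (snd p))\<^sup>2 < 1" using assms(4) by (simp add: abs_square_less_1)
  have "(norm (fst p))\<^sup>2 \<le> R\<^sup>2" using assms(3) by (simp add: power_mono)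
  then have "norm (fst p) * (1 + (norm (snd p))\<^sup>2) * exp (\<kappa> * (norm (fst p))\<^sup>2 * (1 + (norm (snd p))\<^sup>2) / 2)
      \<le> R * (1 + (norm (snd p))\<^sup>2) * exp (\<kappa> * R\<^sup>2 * 2 / 2)"
    using assms e by (intro mult_mono iffD2[OF exp_le_cancel_iff] divide_right_mono) auto
  also have "\<dots> < R * 2 * exp (\<kappa> * R\<^sup>2 * 2 / 2)"
    using assms(1) e by (intro mult_strict_right_mono mult_strict_left_mono) auto
  finally show ?thesis using norm_pos_integral_le[OF assms(2), of p] by (simp add: mult.commute)
qed

text \<open>
  The antiholomorphic derivative of a smooth extension is continuous, so it vanishes on the
  closed disk.
\<close>

lemma smooth_extension_holomorphic_cball:
  assumes B: "smooth_extension (cball 0 r) f U B" and hol: "f holomorphic_on ball 0 r"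
    and r: "0 < r" and z: "z \<in> cball 0 r"
  shows "\<exists>b. (B has_field_derivative b) (at z)"
proof -
  define D where "D z = frechet_derivative B (at z)" for z
  have U: "cball 0 r \<subseteq> U" and Bf: "\<And>z. z \<in> cball 0 r \<Longrightarrow> B z = f z" and Ck: "\<And>k. Ck_on k U B"
    using B unfolding smooth_extension_def by auto
  have D: "(B has_derivative D z) (at z)" if "z \<in> cball 0 r" for z
    using smooth_extension_differentiable[OF B that] by (simp add: D_def)
  have holB: "B holomorphic_on ball 0 r"
    by (rule holomorphic_transform[OF hol]) (simp add: Bf)
  have "continuous_on U (\<lambda>z. D z h)" for h
    using Ck_on_imp_continuous_on[OF Ck_on_Suc_deriv[OF Ck[of "Suc 0"]]] by (simp add: D_def)
  then have "continuous_on (cball 0 r) (\<lambda>z. D z \<i> - \<i> * D z 1)"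
    by (intro continuous_intros continuous_on_subset[OF _ U])
  moreover have "D z \<i> - \<i> * D z 1 = 0" if "z \<in> ball 0 r" for z
  proof -
    have "(B has_derivative (*) (deriv B z)) (at z)"
      using holomorphic_derivI[OF holB open_ball that] by (simp add: has_field_derivative_def)
    then have "D z = (*) (deriv B z)"
      using that by (intro has_derivative_unique[OF D]) auto
    then show ?thesis by simp
  qed
  ultimately have "D z \<i> - \<i> * D z 1 = 0"
    using continuous_constant_on_closure[of "ball 0 r" "\<lambda>z. D z \<i> - \<i> * D z 1" 0 z] r z by simp
  then have Di: "D z \<i> = \<i> * D z 1" by simp
  have lin: "linear (D z)" using D[OF z] by (rule has_derivative_linear)
  have "D z h = D z 1 * h" for h
  proof -
    have "D z (Re h *\<^sub>R 1 + Im h *\<^sub>R \<i>) = D z 1 * (of_real (Re h) + \<i> * of_real (Im h))"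
      unfolding linear_add[OF lin] linear_scale[OF lin] Di by (simp add: scaleR_conv_of_real algebra_simps)
    then show ?thesis by (simp add: complex_eq[symmetric] scaleR_conv_of_real mult.commute[of _ \<i>])
  qed
  then have Dz: "D z = (*) (D z 1)" by (rule ext)
  have "(B has_derivative (*) (D z 1)) (at z)" by (subst Dz[symmetric]) (rule D[OF z])
  then show ?thesis unfolding has_field_derivative_def by blast
qed

section \<open>The first integrals on the zero section and the coordinate zeta\<close>

lemma pos_integral_0: "pos_integral \<kappa> (x, 0) = zeta \<kappa> x"
  by (simp add: pos_integral_def weight_def zeta_def algebra_simps)

text \<open>Differentiates \<open>pos_integral\<close> along the zero section. The result is complex
  linear in the frame coordinate, and it is the leading mode of \<open>dir_integral\<close>.\<close>

lemma frechet_derivative_zeta: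
  "frechet_derivative (zeta \<kappa>) (at x) v = weight \<kappa> (x, 0) * frame_coord \<kappa> x v"
proof -
  have "d_pos_integral \<kappa> (x, 0) v (cnj v) 0 = weight \<kappa> (x, 0) * frame_coord \<kappa> x v" for v
  proof -
    have "of_real (x \<bullet> v) = (cnj x * v + x * cnj v) / 2"
      by (simp add: inner_complex_def complex_eq_iff algebra_simps)
    then show ?thesis
      unfolding d_pos_integral_def d_log_weight_def frame_coord_def of_real_mult by simp
  qed
  moreover have "(zeta \<kappa> has_derivative (\<lambda>h. d_pos_integral \<kappa> (x, 0) h (cnj h) 0)) (at x)"
    using has_derivative_compose[OF has_derivative_Pair[OF has_derivative_ident has_derivative_const]
        has_derivative_pos_integral[of \<kappa> "(x, 0)"]]
    by (simp add: pos_integral_0)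
  ultimately show ?thesis by (simp add: frechet_derivative_at[symmetric])
qed

lemma norm_zeta: "norm (zeta \<kappa> x) = norm x * exp (\<kappa> * (norm x)\<^sup>2 / 2)"
  by (simp add: zeta_def norm_mult cmod_power2[symmetric] complex_mult_cnj mult.assoc flip: of_real_mult)

lemma norm_zeta_less:
  assumes "0 \<le> \<kappa>" "norm x < R"
  shows "norm (zeta \<kappa> x) < R * exp (\<kappa> * R\<^sup>2 / 2)"
proof -
  have "(norm x)\<^sup>2 \<le> R\<^sup>2" using assms(2) by (intro power_mono) auto
  then have "exp (\<kappa> * (norm x)\<^sup>2 / 2) \<le> exp (\<kappa> * R\<^sup>2 / 2)"
    using assms(1) by (intro iffD2[OF exp_le_cancel_iff] divide_right_mono mult_left_mono) auto
  then show ?thesis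
    unfolding norm_zeta using assms(2) by (intro mult_less_le_imp_less) auto
qed


section \<open>The invariant extension of a holomorphic differential\<close>

text \<open>Here \<open>f\<close> is the given coefficient, whose values matter on the closed disk
  only, and \<open>B\<close> is an extension to \<open>U\<close>, merely smooth outside that
  disk.\<close>

locale extended_coefficient =
  fixes R \<kappa> :: real and m :: nat and f B :: "complex \<Rightarrow> complex" and U :: "complex set"
  assumes R: "0 < R" and \<kappa>: "0 \<le> \<kappa>"
    and ext: "smooth_extension (cball 0 (2 * R * exp (\<kappa> * R\<^sup>2))) f U B"
    and hol: "f holomorphic_on ball 0 (2 * R * exp (\<kappa> * R\<^sup>2))"
begin

definition "W = pos_integral \<kappa> -` U"

text \<open>The invariant function in the chart \<open>(x, E)\<close> with its factor
  \<open>E ^ m\<close> divided out, so the Taylor coefficient of order \<open>n\<close> belongs to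
  the mode \<open>m + n\<close>.\<close>

definition "H p = B (pos_integral \<kappa> p) * weight \<kappa> p ^ m"

definition "F p = integral_fun \<kappa> m B (frame_chart \<kappa> p)"

definition "\<gamma> n x = (fibre_derivative ^^ n) H (x, 0) / fact n"

definition "mode k p = (if int m \<le> k
  then \<gamma> (nat (k - int m)) (fst p) * frame_coord \<kappa> (fst p) (snd p) ^ nat k else 0)"

lemma open_W: "open W"
  unfolding W_def using ext Ck_on_imp_continuous_on[OF Ck_on_pos_integral[of 0]]
  by (intro open_vimage) (auto simp: smooth_extension_def)

lemma Ck_on_B: "Ck_on k U B" and open_U: "open U"
  using ext by (auto simp: smooth_extension_def)

lemma Ck_on_B_pos_integral: "Ck_on k W (\<lambda>p. B (pos_integral \<kappa> p))"
  by (rule Ck_on_compose[OF open_U open_W _ Ck_on_B Ck_on_subset[OF Ck_on_pos_integral]]) (auto simp: W_def)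

lemma Ck_on_H: "Ck_on k W H"
  unfolding H_def[abs_def]
  by (intro Ck_on_mult Ck_on_power open_W Ck_on_B_pos_integral Ck_on_subset[OF Ck_on_weight] subset_UNIV)

lemma in_W: "norm (fst p) \<le> R \<Longrightarrow> norm (snd p) \<le> 1 \<Longrightarrow> p \<in> W"
  using pos_integral_in_cball[OF \<kappa>] ext unfolding W_def smooth_extension_def by blast

lemma B_derivative:
  assumes "norm (fst p) \<le> R" "norm (snd p) \<le> 1"
  obtains b where "(B has_field_derivative b) (at (pos_integral \<kappa> p))"
  using smooth_extension_holomorphic_cball[OF ext hol _ pos_integral_in_cball[OF \<kappa> assms]] R by auto

lemma smooth_extension_F:
  assumes "S \<subseteq> BM R \<kappa>"
  shows "smooth_extension S F (frame_chart \<kappa> -` W) F"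
  unfolding smooth_extension_def
proof (intro conjI allI ballI refl)
  show V: "open (frame_chart \<kappa> -` W)"
    using Ck_on_imp_continuous_on[OF Ck_on_frame_chart[of 0]] open_W by (intro open_vimage)
  show "S \<subseteq> frame_chart \<kappa> -` W"
    using assms by (auto simp: BM_iff frame_chart_def intro!: in_W dest!: subsetD)
  fix k
  have "Ck_on k W (integral_fun \<kappa> m B)"
    unfolding integral_fun_def[abs_def]
    by (intro Ck_on_mult Ck_on_power open_W Ck_on_B_pos_integral Ck_on_subset[OF Ck_on_dir_integral] subset_UNIV)
  note comp = Ck_on_compose[OF open_W V _ this Ck_on_subset[OF Ck_on_frame_chart]]
  show "Ck_on k (frame_chart \<kappa> -` W) F"
    unfolding F_def[abs_def] by (rule comp) auto
qed

lemma SM_subset_BM: "SM R \<kappa> \<subseteq> BM R \<kappa>"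
  by (auto simp: SM_iff BM_iff)

lemma F_twistor_holomorphic: "F \<in> twistor_holomorphic R \<kappa>"
proof -
  have "capply (frechet_derivative F (at q)) \<xi> = 0"
    if q: "q \<in> BM R \<kappa>" and \<xi>: "\<xi> \<in> twistor_distribution R \<kappa> q" for q \<xi>
  proof -
    obtain b where b: "(B has_field_derivative b) (at (pos_integral \<kappa> (frame_chart \<kappa> q)))"
      using q by (auto simp: BM_iff frame_chart_def intro: B_derivative[of "frame_chart \<kappa> q"])
    show ?thesis
      using \<xi> twistor_derivative_eq_0[OF \<kappa> _ _ b] unfolding F_def[abs_def] twistor_distribution_def
      by (auto simp: SM_iff)
  qed
  then show ?thesis
    unfolding twistor_holomorphic_def using smooth_extension_F[OF subset_refl] by blast
qed

lemma F_geodesic_invariant: "has_lie_derivative_on (SM R \<kappa>) (geodesic_field \<kappa>) F (\<lambda>_. 0)"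
proof -
  have "frechet_derivative F (at p) (geodesic_field \<kappa> p) = 0" if p: "p \<in> SM R \<kappa>" for p
  proof -
    obtain b where b: "(B has_field_derivative b) (at (pos_integral \<kappa> (frame_chart \<kappa> p)))"
      using p by (auto simp: SM_iff frame_chart_def intro: B_derivative[of "frame_chart \<kappa> p"])
    show ?thesis
      using p geodesic_derivative_eq_0[OF \<kappa> _ b] unfolding F_def[abs_def] by (simp add: SM_iff)
  qed
  then show ?thesis
    unfolding has_lie_derivative_on_def using smooth_extension_F[OF SM_subset_BM] by blast
qed

text \<open>The coefficient is constant on fibres, and the circle field differentiates the frame
  coordinate to \<open>\<i>\<close> times itself, so the power of exponent \<open>k\<close> is an
  eigenfunction.\<close>

lemma mode_Omega: "mode k \<in> Omega R \<kappa> k"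
proof (cases "int m \<le> k")
  case False
  have "smooth_extension (SM R \<kappa>) (mode k) UNIV (\<lambda>_. 0)"
    using False by (auto simp: smooth_extension_def mode_def)
  then show ?thesis
    unfolding Omega_def has_lie_derivative_on_def using False
    by (auto simp: mode_def intro!: exI[of _ UNIV] exI[of _ "\<lambda>_. 0"])
next
  case True
  define j n where "j = nat (k - int m)" and "n = nat k"
  define V where "V = {x. (x, 0) \<in> W}"
  define G where "G = (\<lambda>p. \<gamma> j (fst p) * frame_coord \<kappa> (fst p) (snd p) ^ n)"
  have m: "mode k = G" using True by (simp add: mode_def G_def j_def n_def fun_eq_iff)
  have V: "open V"
    using open_vimage[OF open_W, of "\<lambda>x. (x, 0)"] unfolding V_def vimage_def by (simp add: continuous_on_Pair)
  have Ck\<gamma>: "Ck_on i V (\<gamma> j)" for i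
    unfolding \<gamma>_def[abs_def] V_def by (rule Ck_fibre_taylor[OF open_W Ck_on_H])
  define V' where "V' = (fst -` V :: (complex \<times> complex) set)"
  have V': "open V'"
    unfolding V'_def using V by (rule open_vimage_fst)
  have Ck_fc: "Ck_on i A (\<lambda>p. frame_coord \<kappa> (fst p) (snd p))" for i and A :: "(complex \<times> complex) set"
    by (rule Ck_on_subset[OF Ck_on_frame_coord subset_UNIV])
  have sub: "p \<in> V'" if "p \<in> SM R \<kappa>" for p
    using that by (auto simp: V'_def V_def SM_iff intro!: in_W)
  have "Ck_on i V' (\<lambda>p. \<gamma> j (fst p))" for i
    by (rule Ck_on_compose[OF V V' _ Ck\<gamma> Ck_on_fst]) (auto simp: V'_def)
  then have G: "smooth_extension (SM R \<kappa>) G V' G"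
    unfolding smooth_extension_def G_def using V' sub
    by (auto intro!: Ck_on_mult Ck_on_power Ck_fc)
  have "frechet_derivative G (at p) (circle_field \<kappa> p) = \<i> * of_int k * G p" if p: "p \<in> SM R \<kappa>" for p
  proof -
    have "(\<gamma> j has_derivative frechet_derivative (\<gamma> j) (at (fst p))) (at (fst p))"
      using sub[OF p] by (intro Ck_on_Suc_has_derivative[OF Ck\<gamma>[of "Suc 0"]]) (simp add: V'_def)
    from has_derivative_compose[OF has_derivative_fst[OF has_derivative_ident] this]
    have "(G has_derivative (\<lambda>h. \<gamma> j (fst p) * (of_nat n * d_frame_coord \<kappa> p h * frame_coord \<kappa> (fst p) (snd p) ^ (n - 1))
        + frechet_derivative (\<gamma> j) (at (fst p)) (fst h) * frame_coord \<kappa> (fst p) (snd p) ^ n)) (at p)"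
      unfolding G_def by (rule has_derivative_eq_rhs[OF has_derivative_mult[OF _ has_derivative_power[OF has_derivative_frame_coord]]])
        (auto intro!: has_derivative_ident has_derivative_fst has_derivative_snd)
    note d = frechet_derivative_at[OF this, symmetric]
    have "linear (frechet_derivative (\<gamma> j) (at (fst p)))"
      using \<open>(\<gamma> j has_derivative _) _\<close> by (rule has_derivative_linear)
    then show ?thesis
      unfolding d circle_field_def case_prod_unfold
      \<comment> \<open>The case \<open>n = 0\<close> is separate because the exponent
        \<open>n - 1\<close> of the power rule is truncated there.\<close>
      using True by (cases n) (auto simp: linear_0 frame_coord_rot[OF \<kappa>] G_def n_def[symmetric] of_nat_nat[symmetric])
  qed
  then show ?thesis
    unfolding Omega_def has_lie_derivative_on_def m using G by blast
qed

text \<open>For \<open>norm e < 1\<close> the values of \<open>pos_integral\<close> lie in the open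
  disk, where \<open>B\<close> is holomorphic. The circle \<open>norm e = 1\<close>, which is what
  \<open>SM\<close> needs, is reached through the smoothness of \<open>H\<close> near the closed
  fibre disk.\<close>

lemma H_has_sum:
  assumes "norm x \<le> R" "norm e \<le> 1"
  shows "((\<lambda>n. \<gamma> n x * e ^ n) has_sum H (x, e)) UNIV"
  unfolding \<gamma>_def
proof (rule has_sum_fibre_taylor[OF open_W Ck_on_H])
  show "{x} \<times> cball 0 1 \<subseteq> W" using assms by (auto intro!: in_W)
  show "e \<in> cball 0 1" using assms by simp
  have h: "(\<lambda>e. weight \<kappa> (x, e)) holomorphic_on A" "(\<lambda>e. pos_integral \<kappa> (x, e)) holomorphic_on A" for A
    unfolding pos_integral_def weight_def by (auto intro!: holomorphic_intros)
  have "B holomorphic_on ball 0 (2 * R * exp (\<kappa> * R\<^sup>2))"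
    by (rule holomorphic_transform[OF hol]) (use ext in \<open>auto simp: smooth_extension_def\<close>)
  then have "(B \<circ> (\<lambda>e. pos_integral \<kappa> (x, e))) holomorphic_on ball 0 1"
    by (rule holomorphic_on_compose_gen[OF h(2)]) (use pos_integral_in_ball[OF R \<kappa>] assms in auto)
  then show "(\<lambda>e. H (x, e)) holomorphic_on ball 0 1"
    unfolding H_def o_def by (intro holomorphic_intros h)
qed

lemma mode_has_sum:
  assumes p: "p \<in> SM R \<kappa>"
  shows "((\<lambda>k. mode k p) has_sum F p) {int m..}"
proof -
  define x e where "x = fst p" and "e = frame_coord \<kappa> (fst p) (snd p)"
  have "norm x \<le> R" "norm e \<le> 1" using p by (simp_all add: SM_iff x_def e_def)
  \<comment> \<open>Restores the factor \<open>E ^ m\<close>, which shifts the Taylor index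
    \<open>n\<close> to the mode \<open>m + n\<close>.\<close>
  from has_sum_cmult_left[OF H_has_sum[OF this], of "e ^ m"]
  have "((\<lambda>n. mode (int m + int n) p) has_sum F p) UNIV"
    by (simp add: mode_def F_def integral_fun_def frame_chart_def H_def dir_integral_def x_def e_def
        nat_add_distrib power_add power_mult_distrib mult_ac)
  moreover have bij: "bij_betw (\<lambda>n. int m + int n) UNIV {int m..}"
    by (rule bij_betwI[of _ _ _ "\<lambda>k. nat (k - int m)"]) auto
  ultimately show ?thesis
    using has_sum_reindex_bij_betw[OF bij, of "\<lambda>k. mode k p"] by simp
qed

lemma F_decomposition:
  shows "fourier_decomposition R \<kappa> {int m..} F mode" and "fourier_decomposition R \<kappa> UNIV F mode"
proof -
  show "fourier_decomposition R \<kappa> {int m..} F mode"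
    unfolding fourier_decomposition_def using mode_Omega mode_has_sum by blast
  have "((\<lambda>k. mode k p) has_sum F p) UNIV \<longleftrightarrow> ((\<lambda>k. mode k p) has_sum F p) {int m..}" for p
    by (rule has_sum_cong_neutral) (auto simp: mode_def)
  then show "fourier_decomposition R \<kappa> UNIV F mode"
    unfolding fourier_decomposition_def using mode_Omega mode_has_sum by blast
qed

lemma fourier_mode_F: "p \<in> SM R \<kappa> \<Longrightarrow> fourier_mode R \<kappa> k F p = mode k p"
  by (rule fourier_mode_eq[OF \<kappa> F_decomposition(2)])

text \<open>At \<open>E = 0\<close> the function \<open>H\<close> is
  \<open>B (zeta \<kappa> x) * weight \<kappa> (x, 0) ^ m\<close>, and this weight combines with
  \<open>E ^ m\<close> to the power of the differential of zeta.\<close>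

lemma leading_mode:
  "mode (int m) (x, v) = f (zeta \<kappa> x) * frechet_derivative (zeta \<kappa>) (at x) v ^ m" if "norm x \<le> R"
proof -
  have "zeta \<kappa> x \<in> cball 0 (2 * R * exp (\<kappa> * R\<^sup>2))"
    using pos_integral_in_cball[OF \<kappa>, of "(x, 0)" R] that by (simp add: pos_integral_0)
  then have "B (zeta \<kappa> x) = f (zeta \<kappa> x)" using ext unfolding smooth_extension_def by blast
  then show ?thesis
    by (simp add: mode_def \<gamma>_def H_def pos_integral_0 frechet_derivative_zeta power_mult_distrib)
qed

end

text \<open>\<open>A\<close> agrees with \<open>f\<close> only on the open disk, so the identity
  first holds over interior points. With \<open>v\<close> fixed, both sides are continuous in the
  base point, the left one by smoothness of the tensor section, and this gives the boundary
  points.\<close>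

lemma (in extended_coefficient) associated_eq_mode:
  assumes a: "tensor_section R \<kappa> m a"
    and A: "has_coefficient (cball 0 R) m a (zeta \<kappa>) (\<lambda>x. A (zeta \<kappa> x))"
    and Af: "\<And>z. z \<in> ball 0 (R * exp (\<kappa> * R\<^sup>2 / 2)) \<Longrightarrow> A z = f z"
    and p: "p \<in> SM R \<kappa>"
  shows "associated m a p = mode (int m) p"
proof -
  obtain x v where xv: "p = (x, v)" "norm x \<le> R" using p by (cases p) (auto simp: SM_iff)
  define g where "g y = f (zeta \<kappa> y) * frechet_derivative (zeta \<kappa>) (at y) v ^ m" for y
  have a_eq: "a y (replicate m v) = A (zeta \<kappa> y) * frechet_derivative (zeta \<kappa>) (at y) v ^ m"
    if "y \<in> cball 0 R" for y
    using A that unfolding has_coefficient_def by (simp add: prod_list_replicate)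
  have "smooth_on (cball 0 R) (\<lambda>y. a y (replicate m v))"
    using a unfolding tensor_section_def by simp
  then have "continuous_on (cball 0 R) (\<lambda>y. a y (replicate m v))"
    by (rule smooth_on_imp_continuous_on)
  moreover have "continuous_on (cball 0 R) g"
  proof -
    have "smooth_on (cball 0 (2 * R * exp (\<kappa> * R\<^sup>2))) f" using ext unfolding smooth_on_def by blast
    then have "continuous_on (cball 0 (2 * R * exp (\<kappa> * R\<^sup>2))) f"
      by (rule smooth_on_imp_continuous_on)
    moreover have "continuous_on (cball 0 R) (zeta \<kappa>)"
      unfolding zeta_def[abs_def] by (intro continuous_intros; simp)
    moreover have "zeta \<kappa> ` cball 0 R \<subseteq> cball 0 (2 * R * exp (\<kappa> * R\<^sup>2))"
      using pos_integral_in_cball[OF \<kappa>, of "(_, 0)" R] by (auto simp: pos_integral_0)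
    ultimately have "continuous_on (cball 0 R) (\<lambda>y. f (zeta \<kappa> y))"
      by (rule continuous_on_compose2)
    then show ?thesis
      unfolding g_def frechet_derivative_zeta weight_def frame_coord_def fst_conv snd_conv
      by (intro continuous_intros; simp)
  qed
  ultimately have "continuous_on (closure (ball 0 R)) (\<lambda>y. a y (replicate m v) - g y)"
    using R by (simp add: continuous_on_diff)
  moreover have "a y (replicate m v) - g y = 0" if "y \<in> ball 0 R" for y
    using that norm_zeta_less[OF \<kappa>, of y R] by (simp add: a_eq g_def Af)
  ultimately have "a x (replicate m v) - g x = 0"
    using continuous_constant_on_closure[of "ball 0 R" "\<lambda>y. a y (replicate m v) - g y" 0 x] xv(2) R by simp
  then show ?thesis
    using leading_mode[OF xv(2)] by (simp add: associated_def xv(1) g_def)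
qed

theorem corollary2:
  fixes R \<kappa> R1 R2 :: real and m :: nat
    and a :: "complex \<Rightarrow> complex list \<Rightarrow> complex"
  assumes "0 < R" and "0 \<le> \<kappa>"
    and "R1 = R * exp (\<kappa> * R\<^sup>2 / 2)" and "R2 = 2 * R * exp (\<kappa> * R\<^sup>2)"
    and "a \<in> holomorphic_differentials R \<kappa> m"
    and "extends_smoothly R \<kappa> m a R2"
  shows "R1 < R2 \<and>
    (\<exists>f\<in>twistor_holomorphic_ge R \<kappa> (int m). has_pushforward R \<kappa> m f a) \<and>
    (\<exists>u. smooth_on (SM R \<kappa>) u \<and>
       has_lie_derivative_on (SM R \<kappa>) (geodesic_field \<kappa>) u (\<lambda>_. 0) \<and>
       (\<forall>p\<in>SM R \<kappa>. fourier_mode R \<kappa> (int m) u p = associated m a p) \<and>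
       (\<forall>k<int m. \<forall>p\<in>SM R \<kappa>. fourier_mode R \<kappa> k u p = 0))"
proof -
  have "exp (\<kappa> * R\<^sup>2 / 2) \<le> exp (\<kappa> * R\<^sup>2)" using assms(2) by simp
  then have "R * exp (\<kappa> * R\<^sup>2 / 2) \<le> R * exp (\<kappa> * R\<^sup>2)" using assms(1) by simp
  also have "\<dots> < R2" using assms(1,4) by simp
  finally have R12: "R1 < R2" using assms(3) by simp
  obtain A c B where A: "has_coefficient (cball 0 R) m a (zeta \<kappa>) (\<lambda>x. A (zeta \<kappa> x))"
    and Ac: "\<And>z. z \<in> ball 0 R1 \<Longrightarrow> (\<lambda>k. c k * z ^ k) sums A z"
    and c: "ereal R2 \<le> conv_radius c"
    and B: "smooth_on (cball 0 R2) B" and Bc: "\<And>z. z \<in> ball 0 R2 \<Longrightarrow> B z = (\<Sum>k. c k * z ^ k)"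
    using assms(3,6) unfolding extends_smoothly_def by blast
  obtain U B' where B': "smooth_extension (cball 0 R2) B U B'" using B unfolding smooth_on_def by blast
  have "(\<lambda>k. c k * (z - 0) ^ k) sums B z" if "z \<in> ball 0 R2" for z
  proof -
    have "ereal (norm z) < conv_radius c" using that by (intro less_le_trans[OF _ c]) simp
    then have "summable (\<lambda>k. c k * z ^ k)" by (rule summable_in_conv_radius)
    then show ?thesis using Bc[OF that] by (simp add: summable_sums)
  qed
  then have hol: "B holomorphic_on ball 0 R2" by (rule power_series_holomorphic)
  \<comment> \<open>The boundary-smooth sum \<open>B\<close> takes the role of \<open>f\<close>, and
    its extension \<open>B'\<close> the role of the locale's \<open>B\<close>.\<close>
  interpret extended_coefficient R \<kappa> m B B' U
    using assms(1,2,4) B' hol by unfold_locales simp_all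
  have "A z = B z" if "z \<in> ball 0 R1" for z
    using Ac[OF that] Bc[of z] that R12 by (simp add: sums_iff)
  then have assoc: "associated m a p = mode (int m) p" if "p \<in> SM R \<kappa>" for p
    using assms(3,5) A that by (intro associated_eq_mode[where A = A]) (auto simp: holomorphic_differentials_def)
  \<comment> \<open>The same \<open>F\<close> witnesses both formulations: on \<open>BM\<close> as
    the twistor holomorphic function and on \<open>SM\<close> as the flow invariant one.\<close>
  have "F \<in> twistor_holomorphic_ge R \<kappa> (int m)"
    unfolding twistor_holomorphic_ge_def using F_twistor_holomorphic F_decomposition(1) by blast
  moreover have "has_pushforward R \<kappa> m F a"
    unfolding has_pushforward_def using assms(5) by (simp add: assoc fourier_mode_F)
  moreover have "smooth_on (SM R \<kappa>) F"
    unfolding smooth_on_def using smooth_extension_F[OF SM_subset_BM] by blast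
  moreover have "fourier_mode R \<kappa> k F p = 0" if "k < int m" "p \<in> SM R \<kappa>" for k p
    using that by (simp add: fourier_mode_F mode_def)
  ultimately show ?thesis
    using R12 F_geodesic_invariant assoc fourier_mode_F by auto
qed

end
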